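(* For any $\epsilon>0$, as $k$ ranges over the positive integers, $$f(\mathbb{N}_k)=1+O_\epsilon\big(k^{-1/2+\epsilon}\big)\qquad\text{and}\qquad f(\mathbb{N}^*_k)=\frac{6}{\pi^2}+O_\epsilon\big(k^{-1/2+\epsilon}\big),$$ where the implied constants depend only on $\epsilon$.
   Context: For a positive integer $n$, $\Omega(n)$ denotes the number of prime factors of $n$ counted with multiplicity. For each integer $k\ge 1$, $\mathbb{N}_k=\{n\ge 1:\Omega(n)=k\}$ is the set of $k$-almost primes, and $\mathbb{N}^*_k$ is the set of squarefree members of $\mathbb{N}_k$. For a set $A$ of integers $>1$, $f(A):=\sum_{n\in A}\frac{1}{n\log n}$. *)

theory Defs
  imports "HOL-Analysis.Analysis" "HOL-Computational_Algebra.Squarefree"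
begin

definition prime_Omega :: "nat \<Rightarrow> nat" where
  "prime_Omega n = size (prime_factorization n)"

definition almost_primes :: "nat \<Rightarrow> nat set" where
  "almost_primes k = {n. n \<ge> 1 \<and> prime_Omega n = k}"

definition squarefree_almost_primes :: "nat \<Rightarrow> nat set" where
  "squarefree_almost_primes k = {n \<in> almost_primes k. squarefree n}"

definition erdos_term :: "nat \<Rightarrow> real" where
  "erdos_term n = 1 / (real n * ln (real n))"

text \<open>Intended for sets of integers greater than 1. Since \<^const>\<open>infsum\<close> is 0 on families that are
  not summable, convergence has to be stated separately.\<close>

definition erdos_sum :: "nat set \<Rightarrow> real" where
  "erdos_sum A = (\<Sum>\<^sub>\<infinity>n\<in>A. erdos_term n)"

end

(*
Since 1/(n log n) is the integral of n^(-s) over s > 1, the sum over the k-almost primes is, up to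
O(1/k) from s > 2, the integral over 1 < s < 2 of P_k(s), the sum of n^(-s) over Omega(n) = k.
Newton's identities give the P_k(s) the generating function exp(sum_i z^i P(i s)/i) with P the prime
zeta function. Put t = s - 1 and L = log(1/t), so that P(1 + t) = L + O(1). Dividing by exp(z L)
leaves coefficients h_j(t) that decay like (2/3)^j, uniformly in t, with sum t zeta(1 + t) = 1 + O(t),
and P_k(1 + t) is the sum over j of h_j(t) L^(k-j)/(k-j)!. The functions L^m/m! have integral 1 over
0 < t < 1, and consecutive ones are at L1-distance at most (m+1)^(-1/2), so L^(k-j)/(k-j)! may be
replaced by L^k/k! with total error O(k^(-1/2)). For squarefree numbers the signs in Newton's
identities alternate, and the sum of the h_j(t) is t zeta(1 + t)/zeta(2 + 2t) = 6/pi^2 + O(t).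
*)
theory Submission
  imports Defs
begin

section \<open>Integrals of powers of the logarithm\<close>

text \<open>The obstacle is uniformity as t tends to 0, where P(1 + t) is unbounded. Only the term i
  = 1 of the logarithm carries that singularity, and exp(z L) matches it up to a bounded amount. The
  terms with i >= 2 decay like 2^(-i), because 2 is the smallest prime. The base 2/3 exceeds 1/2,
  which leaves room for the constants, and lies below 1, so that z = 1 is interior to the disc of
  convergence and the decay beats the factor j (j + 1) that comes from moving the index by j. The
  error O(t) is harmless: under the weight L^k/k! the mean of t is 2^(-k-1). No Euler product is
  used. Newton's identities come from counting each prime p of n with its multiplicity, and log
  zeta(s) = sum_i P(i s)/i comes from the trivial weight by putting z = 1. The squarefree case runs
  through the same lemmas, with a sign \<sigma> = -1 in place of 1.\<close>

definition psi :: "nat \<Rightarrow> real \<Rightarrow> real" where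
  "psi m t = (- ln t) ^ m / fact m"

abbreviation unit_interval_measure :: "real measure" where
  "unit_interval_measure \<equiv> restrict_space lborel {0<..<1}"

lemma psi_0 [simp]: "psi 0 t = 1"
  by (simp add: psi_def)

lemma psi_nonneg: "0 < t \<Longrightarrow> t < 1 \<Longrightarrow> psi m t \<ge> 0"
  by (simp add: psi_def)

lemma psi_Suc: "- ln t * psi m t = real (Suc m) * psi (Suc m) t"
  by (simp add: psi_def divide_simps del: of_nat_Suc)

lemma deriv_psi_Suc:
  assumes "t > 0"
  shows "(psi (Suc m) has_real_derivative - psi m t / t) (at t)"
proof -
  have "((\<lambda>t. (- ln t) ^ Suc m / fact (Suc m)) has_real_derivative
      real (Suc m) * (- ln t) ^ m * (- (1 / t)) / fact (Suc m)) (at t)"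
    using assms by (auto intro!: derivative_eq_intros simp del: power_Suc fact_Suc)
  also have "real (Suc m) * (- ln t) ^ m * (- (1 / t)) / fact (Suc m) = - psi m t / t"
    by (simp add: psi_def divide_simps del: of_nat_Suc)
  finally show ?thesis by (simp only: psi_def[abs_def])
qed

lemma tendsto_power_psi: "((\<lambda>t. t ^ Suc c * psi m t) \<longlongrightarrow> 0) (at_right 0)"
proof -
  have "filterlim (\<lambda>t::real. - ln t) at_top (at_right 0)"
    using ln_at_0 by (simp add: filterlim_uminus_at_top)
  then have "((\<lambda>t::real. (- ln t) ^ m / exp (- ln t)) \<longlongrightarrow> 0) (at_right 0)"
    by (rule filterlim_compose[OF tendsto_power_div_exp_0])
  then have "((\<lambda>t::real. t ^ c * ((- ln t) ^ m / exp (- ln t)) / fact m) \<longlongrightarrow> 0 ^ c * 0 / fact m) (at_right 0)"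
    by (intro tendsto_intros) auto
  moreover have "\<forall>\<^sub>F t::real in at_right 0. t ^ c * ((- ln t) ^ m / exp (- ln t)) / fact m = t ^ Suc c * psi m t"
    using eventually_at_right_less[of 0] by eventually_elim (simp add: psi_def exp_minus field_simps)
  ultimately show ?thesis by (simp add: tendsto_cong)
qed

text \<open>Repeated integration by parts. The exponents used later are c = 0, which gives
  \<open>psi m\<close> total mass 1, and c = 1, which gives t the mean 2^(-m-1) under that
  weight.\<close>

lemma power_psi_antiderivative:
  fixes c m :: nat
  defines "q \<equiv> 1 / real (Suc c)"
  shows "\<exists>F. (\<forall>t>0. (F has_real_derivative t ^ c * psi m t) (at t)) \<and>
    (F \<longlongrightarrow> 0) (at_right 0) \<and> F 1 = q ^ Suc m"
proof (induction m)
  case 0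
  show ?case
  proof (intro exI[of _ "\<lambda>t. q * t ^ Suc c"] conjI allI impI)
    have "((\<lambda>t. q * t ^ Suc c) \<longlongrightarrow> q * 0 ^ Suc c) (at_right 0)"
      by (intro tendsto_intros)
    then show "((\<lambda>t. q * t ^ Suc c) \<longlongrightarrow> 0) (at_right 0)" by simp
  qed (auto intro!: derivative_eq_intros simp: q_def simp del: power_Suc of_nat_Suc)
next
  case (Suc m)
  then obtain F where F: "\<And>t. t > 0 \<Longrightarrow> (F has_real_derivative t ^ c * psi m t) (at t)"
    "(F \<longlongrightarrow> 0) (at_right 0)" "F 1 = q ^ Suc m" by blast
  have q: "real (Suc c) * q = 1" by (simp add: q_def)
  show ?case
  \<comment> \<open>The derivative of \<open>t ^ Suc c * psi (Suc m) t\<close> is c + 1 times the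
    integrand, minus \<open>t ^ c * psi m t\<close>. Adding \<open>F\<close> cancels the latter, and
    \<open>q\<close> removes the factor c + 1.\<close>
  proof (intro exI[of _ "\<lambda>t. q * (t ^ Suc c * psi (Suc m) t) + q * F t"] conjI allI impI)
    fix t :: real assume t: "t > 0"
    have "((\<lambda>t. q * (t ^ Suc c * psi (Suc m) t) + q * F t) has_real_derivative
      q * (real (Suc c) * t ^ c * psi (Suc m) t + t ^ Suc c * (- psi m t / t)) + q * (t ^ c * psi m t)) (at t)"
      by (rule derivative_eq_intros deriv_psi_Suc F t refl | simp)+
    also have "q * (real (Suc c) * t ^ c * psi (Suc m) t + t ^ Suc c * (- psi m t / t)) + q * (t ^ c * psi m t)
      = (real (Suc c) * q) * (t ^ c * psi (Suc m) t)"
      using t by (simp add: field_simps)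
    finally show "((\<lambda>t. q * (t ^ Suc c * psi (Suc m) t) + q * F t) has_real_derivative
        t ^ c * psi (Suc m) t) (at t)" unfolding q by (simp only: mult_1)
  next
    have "((\<lambda>t. q * (t ^ Suc c * psi (Suc m) t) + q * F t) \<longlongrightarrow> q * 0 + q * 0) (at_right 0)"
      by (intro tendsto_intros tendsto_power_psi F)
    then show "((\<lambda>t. q * (t ^ Suc c * psi (Suc m) t) + q * F t) \<longlongrightarrow> 0) (at_right 0)" by simp
  next
    show "q * (1 ^ Suc c * psi (Suc m) 1) + q * F 1 = q ^ Suc (Suc m)"
      by (simp add: psi_def F)
  qed
qed

lemmas lebesgue_integrable_intros = Bochner_Integration.integrable_add
  Bochner_Integration.integrable_diff Bochner_Integration.integrable_sum
  Bochner_Integration.integrable_mult_right Bochner_Integration.integrable_divide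
  Bochner_Integration.integrable_abs

lemma integral_power_psi:
  shows integrable_power_psi: "integrable unit_interval_measure (\<lambda>t. t ^ c * psi m t)"
    and "(LINT t|unit_interval_measure. t ^ c * psi m t) = (1 / real (Suc c)) ^ Suc m"
proof -
  obtain F where F: "\<And>t. t > 0 \<Longrightarrow> (F has_real_derivative t ^ c * psi m t) (at t)"
    "(F \<longlongrightarrow> 0) (at_right 0)" "F 1 = (1 / real (Suc c)) ^ Suc m"
    using power_psi_antiderivative[of c m] by metis
  have "isCont F 1" using F(1)[of 1] by (intro DERIV_isCont) auto
  then have F1: "(F \<longlongrightarrow> (1 / real (Suc c)) ^ Suc m) (at_left 1)"
    unfolding F(3)[symmetric] isCont_def by (rule tendsto_within_subset) auto
  have "isCont (\<lambda>t. t ^ c * psi m t) t" if "t > 0" for t :: real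
    unfolding psi_def using that by (intro continuous_intros) auto
  then have "set_integrable lborel (einterval (ereal 0) (ereal 1)) (\<lambda>t. t ^ c * psi m t)"
    "(LBINT t=ereal 0..ereal 1. t ^ c * psi m t) = (1 / real (Suc c)) ^ Suc m - 0"
    using F F1 by (intro interval_integral_FTC_nonneg[where F = F] AE_I2;
      simp add: ereal_tendsto_simps psi_nonneg)+
  then show "integrable unit_interval_measure (\<lambda>t. t ^ c * psi m t)"
    "(LINT t|unit_interval_measure. t ^ c * psi m t) = (1 / real (Suc c)) ^ Suc m"
    by (simp_all add: integrable_restrict_space integral_restrict_space set_integrable_def
      set_lebesgue_integral_def interval_lebesgue_integral_def)
qed

lemmas integrable_psi = integrable_power_psi[of 0, simplified]
  and integral_psi = integral_power_psi(2)[of 0, simplified]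

text \<open>The weights are concentrated: \<open>psi m t dt\<close> is the law of \<open>t = exp (-X)\<close> with \<open>X\<close> Gamma
  distributed of shape \<open>m + 1\<close>, and \<open>psi (m + 1) t = psi m t * X / (m + 1)\<close>. So the distance below is the
  mean of \<open>\<bar>1 - X / (m + 1)\<bar>\<close>, which the variance controls.\<close>

lemma psi_L1_step:
  "(LINT t|unit_interval_measure. \<bar>psi m t - psi (Suc m) t\<bar>) \<le> 1 / sqrt (real (Suc m))"
proof -
  define s where "s = sqrt (real (Suc m))"
  have s: "s > 0" "s^2 = real (Suc m)" by (simp_all add: s_def)
  \<comment> \<open>With y = 1 - u/(m + 1), this is the bound 2 |y| <= 1/s + s y^2, halved and
    multiplied by \<open>psi m t\<close>. Expanding y^2 gives a combination of \<open>psi\<close>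
    functions, each of total mass 1. The choice s^2 = m + 1 balances the two parts, as y^2 has mean
    1/s^2.\<close>
  let ?R = "\<lambda>t. (psi m t / s + s * (psi m t - 2 * psi (Suc m) t +
    (s^2 + 1) / s^2 * psi (Suc (Suc m)) t)) / 2"
  have "\<bar>psi m t - psi (Suc m) t\<bar> \<le> ?R t" if t: "t \<in> {0<..<1}" for t
  proof -
    define u where "u = - ln t"
    have p1: "psi (Suc m) t = u / s^2 * psi m t"
      using psi_Suc[of t m] s by (simp add: u_def field_simps)
    have p2: "psi (Suc (Suc m)) t = u^2 / (s^2 * (s^2 + 1)) * psi m t"
    proof -
      have "psi (Suc (Suc m)) t = u / (s^2 + 1) * psi (Suc m) t"
        using psi_Suc[of t "Suc m"] s by (simp add: u_def field_simps)
      then show ?thesis unfolding p1 by (simp add: power2_eq_square mult_ac)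
    qed
    have s1: "s^2 + 1 > 0" using s by simp
    have "psi m t - 2 * psi (Suc m) t + (s^2 + 1) / s^2 * psi (Suc (Suc m)) t
        = (1 - u / s^2)^2 * psi m t"
    proof -
      have "(s^2 + 1) / s^2 * psi (Suc (Suc m)) t = (u / s^2)^2 * psi m t"
        unfolding p2 using s1 s by (simp add: power2_eq_square divide_simps)
      then show ?thesis unfolding p1 by (simp add: power2_eq_square algebra_simps)
    qed
    then have R: "?R t = (1 / s + s * (1 - u / s^2)^2) / 2 * psi m t" by (simp add: algebra_simps)
    define x where "x = s * \<bar>1 - u / s^2\<bar>"
    have "0 \<le> (1 - x)^2" by simp
    then have "2 * x \<le> 1 + x^2" by (simp add: power2_eq_square algebra_simps)
    then have "2 * x / s \<le> (1 + x^2) / s" using s by (simp add: divide_right_mono)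
    also have "(1 + x^2) / s = 1 / s + s * (1 - u / s^2)^2"
      using s by (simp add: x_def power_mult_distrib field_simps power2_eq_square)
    also have "2 * x / s = 2 * \<bar>1 - u / s^2\<bar>" using s by (simp add: x_def)
    finally have "\<bar>1 - u / s^2\<bar> \<le> (1 / s + s * (1 - u / s^2)^2) / 2" by simp
    then have "\<bar>1 - u / s^2\<bar> * psi m t \<le> ?R t"
      unfolding R by (rule mult_right_mono) (use t psi_nonneg in auto)
    moreover have "\<bar>psi m t - psi (Suc m) t\<bar> = \<bar>1 - u / s^2\<bar> * psi m t"
    proof -
      have "psi m t - psi (Suc m) t = (1 - u / s^2) * psi m t" by (simp add: p1 algebra_simps)
      then show ?thesis using t psi_nonneg[of t m] by (simp add: abs_mult)
    qed
    ultimately show ?thesis by simp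
  qed
  then have "(LINT t|unit_interval_measure. \<bar>psi m t - psi (Suc m) t\<bar>) \<le> (LINT t|unit_interval_measure. ?R t)"
    by (intro integral_mono lebesgue_integrable_intros integrable_psi) (simp add: space_restrict_space)
  also have "\<dots> = (1 / s + s * (1 - 2 + (s^2 + 1) / s^2)) / 2"
    by (simp add: integrable_psi integral_psi)
  also have "\<dots> = 1 / s" using s(1) by (simp add: field_simps power2_eq_square)
  finally show ?thesis by (simp add: s_def)
qed

text \<open>Telescoping over j steps. Each step costs 1/sqrt(m + 1) with m >= k - j, and k <= (k - j
  + 1) (j + 1) bounds this by (j + 1)/sqrt k. Thus j near k needs no separate treatment; the
  quadratic loss in j is absorbed later by geometric decay.\<close>

lemma psi_L1_dist:
  assumes "j \<le> k" "k \<ge> 1"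
  shows "(LINT t|unit_interval_measure. \<bar>psi (k - j) t - psi k t\<bar>) \<le> real (j * (j + 1)) / sqrt k"
proof -
  have "(LINT t|unit_interval_measure. \<bar>psi (k - j) t - psi k t\<bar>)
     \<le> (LINT t|unit_interval_measure. (\<Sum>m=k-j..<k. \<bar>psi m t - psi (Suc m) t\<bar>))"
  proof (rule integral_mono)
    fix t
    have "psi k t - psi (k - j) t = (\<Sum>m=k-j..<k. psi (Suc m) t - psi m t)"
      by (rule sum_Suc_diff'[symmetric]) simp
    then have "\<bar>psi (k - j) t - psi k t\<bar> = \<bar>\<Sum>m=k-j..<k. psi (Suc m) t - psi m t\<bar>" by linarith
    also have "\<dots> \<le> (\<Sum>m=k-j..<k. \<bar>psi m t - psi (Suc m) t\<bar>)"
      by (rule order.trans[OF sum_abs]) (simp add: abs_minus_commute)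
    finally show "\<bar>psi (k - j) t - psi k t\<bar> \<le> (\<Sum>m=k-j..<k. \<bar>psi m t - psi (Suc m) t\<bar>)" .
  qed (intro lebesgue_integrable_intros integrable_psi)+
  also have "\<dots> = (\<Sum>m=k-j..<k. LINT t|unit_interval_measure. \<bar>psi m t - psi (Suc m) t\<bar>)"
    by (intro Bochner_Integration.integral_sum lebesgue_integrable_intros integrable_psi)
  also have "\<dots> \<le> (\<Sum>m=k-j..<k. real (j + 1) / sqrt k)"
  proof (rule sum_mono)
    fix m assume m: "m \<in> {k-j..<k}"
    obtain d where "k = j + d" using assms le_Suc_ex by blast
    then have "k \<le> (k - j + 1) * (j + 1)" by simp
    also have "\<dots> \<le> Suc m * (j + 1)" using m by (intro mult_right_mono) auto
    also have "\<dots> \<le> Suc m * (j + 1)^2"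
      by (intro mult_left_mono) (simp_all add: power2_eq_square)
    finally have "real k \<le> real (Suc m * (j + 1)^2)" by (rule of_nat_mono)
    then have "sqrt k \<le> sqrt (real (Suc m * (j + 1)^2))" by (rule real_sqrt_le_mono)
    also have "\<dots> = sqrt (Suc m) * (j + 1)" by (simp only: of_nat_mult of_nat_power real_sqrt_mult real_sqrt_abs abs_of_nat)
    finally have "sqrt k \<le> sqrt (Suc m) * (j + 1)" .
    then have "1 / sqrt (Suc m) \<le> (j + 1) / sqrt k"
      using assms by (simp add: divide_simps mult.commute del: of_nat_Suc)
    then show "(LINT t|unit_interval_measure. \<bar>psi m t - psi (Suc m) t\<bar>) \<le> real (j + 1) / sqrt k"
      using psi_L1_step[of m] by simp
  qed
  also have "\<dots> = real (j * (j + 1)) / sqrt k" using assms by (simp add: algebra_simps)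
  finally show ?thesis .
qed

definition quad_geom :: real where "quad_geom = (\<Sum>j. (2/3) ^ j * real (j * (j + 1)))"

lemma summable_quad_geom: "summable (\<lambda>j. (2/3::real) ^ j * real (j * (j + 1)))"
proof -
  \<comment> \<open>The second derivative of the geometric series at 2/3. A shift of the index then
    turns (j + 1) (j + 2) into j (j + 1).\<close>
  have "summable (\<lambda>j. diffs (diffs (\<lambda>_. 1::real)) j * (2/3) ^ j)"
    by (intro termdiff_converges[where K = 1] summable_geometric) auto
  then have "summable (\<lambda>j. real (Suc j) * real (Suc (Suc j)) * (2/3) ^ j)"
    by (simp add: diffs_def mult_ac)
  then have "summable (\<lambda>j. (2/3) * (real (Suc j) * real (Suc (Suc j)) * (2/3) ^ j))"
    by (rule summable_mult)
  moreover have "(2/3) * (real (Suc j) * real (Suc (Suc j)) * (2/3) ^ j) = (2/3) ^ Suc j * real (Suc j * (Suc j + 1))"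
    for j by (simp add: algebra_simps)
  ultimately have "summable (\<lambda>j. (2/3::real) ^ Suc j * real (Suc j * (Suc j + 1)))"
    by (simp only:)
  then show ?thesis by (subst (asm) summable_Suc_iff)
qed

text \<open>Every weight \<open>psi (k - j)\<close> is exchanged for \<open>psi k\<close>, so that
  the coefficients \<open>h j t\<close> add up to \<open>g t\<close> except for a geometric tail;
  then \<open>g t\<close> is replaced by \<open>K\<close>. The three errors are of order 1/sqrt k,
  (2/3)^k and 2^(-k). They bound \<open>a t - K * psi k t\<close> pointwise, so the integrability of
  \<open>a\<close> comes along. In the factor 4, one part is from the exchange and three are from
  the tail.\<close>

lemma integral_convolution_psi:
  fixes a g :: "real \<Rightarrow> real" and h :: "nat \<Rightarrow> real \<Rightarrow> real"
  assumes [measurable]: "a \<in> borel_measurable unit_interval_measure" and k: "k \<ge> 1"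
    and a: "\<And>t. t \<in> {0<..<1} \<Longrightarrow> a t = (\<Sum>j\<le>k. h j t * psi (k - j) t)"
    and h: "\<And>j t. t \<in> {0<..<1} \<Longrightarrow> \<bar>h j t\<bar> \<le> M * (2/3) ^ j"
    and g: "\<And>t. t \<in> {0<..<1} \<Longrightarrow> (\<lambda>j. h j t) sums g t"
    and gK: "\<And>t. t \<in> {0<..<1} \<Longrightarrow> \<bar>g t - K\<bar> \<le> C * t"
  shows "integrable unit_interval_measure a"
    and "\<bar>(LINT t|unit_interval_measure. a t) - K\<bar> \<le> (4 * M * quad_geom + C) / sqrt k"
proof -
  have "\<bar>h 0 (1/2)\<bar> \<le> M" using h[of "1/2" 0] by simp
  then have M: "M \<ge> 0" by linarith
  have "\<bar>g (1/2) - K\<bar> \<le> C * (1/2)" by (rule gK) simp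
  then have C: "C \<ge> 0" by linarith
  let ?R = "\<lambda>t. (\<Sum>j\<le>k. M * (2/3)^j * \<bar>psi (k - j) t - psi k t\<bar>) + 3 * M * (2/3)^k * psi k t
    + C * (t * psi k t)"
  have itp: "integrable unit_interval_measure (\<lambda>t. t * psi k t)"
    using integrable_power_psi[of 1 k] by simp
  have iR: "integrable unit_interval_measure ?R"
    by (intro lebesgue_integrable_intros integrable_psi itp)
  have bound: "\<bar>a t - K * psi k t\<bar> \<le> ?R t" if t: "t \<in> {0<..<1}" for t
  proof -
    have psi0: "psi k t \<ge> 0" using t psi_nonneg by auto
    have sh: "summable (\<lambda>j. h j t)" "g t = (\<Sum>j. h j t)" using g[OF t] by (auto simp: sums_iff)
    have split: "g t = (\<Sum>j. h (j + Suc k) t) + (\<Sum>j\<le>k. h j t)"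
      unfolding sh(2) using suminf_split_initial_segment[OF sh(1), of "Suc k"]
      by (simp add: lessThan_Suc_atMost)
    have geo: "(\<lambda>j. M * (2/3)^Suc k * (2/3)^j) sums (M * (2/3)^Suc k * (1 / (1 - 2/3)))"
      by (intro sums_mult geometric_sums) auto
    have hb: "norm (h (j + Suc k) t) \<le> M * (2/3)^Suc k * (2/3)^j" for j
      using h[OF t, of "j + Suc k"] by (simp add: power_add mult_ac)
    have "\<bar>\<Sum>j. h (j + Suc k) t\<bar> \<le> (\<Sum>j. M * (2/3)^Suc k * (2/3)^j)"
      using norm_suminf_le[OF hb sums_summable[OF geo]] by (simp only: real_norm_def)
    also have "\<dots> = 2 * (M * (2/3)^k)" using geo by (simp add: sums_iff)
    also have "\<dots> \<le> 3 * M * (2/3)^k" using M by (simp add: mult_right_mono)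
    finally have tail: "\<bar>\<Sum>j. h (j + Suc k) t\<bar> \<le> 3 * M * (2/3)^k" .
    have "a t - K * psi k t = (\<Sum>j\<le>k. h j t * (psi (k - j) t - psi k t))
        - (\<Sum>j. h (j + Suc k) t) * psi k t + (g t - K) * psi k t"
      by (simp add: a[OF t] split sum_subtractf sum_distrib_left algebra_simps)
    also have "\<bar>\<dots>\<bar> \<le> (\<Sum>j\<le>k. M * (2/3)^j * \<bar>psi (k - j) t - psi k t\<bar>)
        + 3 * M * (2/3)^k * psi k t + C * t * psi k t"
    proof -
      have "\<bar>\<Sum>j\<le>k. h j t * (psi (k - j) t - psi k t)\<bar>
          \<le> (\<Sum>j\<le>k. M * (2/3)^j * \<bar>psi (k - j) t - psi k t\<bar>)"
        by (rule order.trans[OF sum_abs]) (auto simp: abs_mult intro!: sum_mono mult_right_mono h t)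
      moreover have "\<bar>(\<Sum>j. h (j + Suc k) t) * psi k t\<bar> \<le> 3 * M * (2/3)^k * psi k t"
        using mult_right_mono[OF tail psi0] psi0 by (simp add: abs_mult)
      moreover have "\<bar>(g t - K) * psi k t\<bar> \<le> C * t * psi k t"
        using mult_right_mono[OF gK[OF t] psi0] psi0 by (simp add: abs_mult)
      ultimately show ?thesis by linarith
    qed
    finally show ?thesis by (simp add: mult.assoc)
  qed
  have iKp: "integrable unit_interval_measure (\<lambda>t. K * psi k t)"
    by (intro lebesgue_integrable_intros integrable_psi)
  have id: "integrable unit_interval_measure (\<lambda>t. a t - K * psi k t)"
  proof (rule Bochner_Integration.integrable_bound[OF iR])
    show "AE t in unit_interval_measure. norm (a t - K * psi k t) \<le> norm (?R t)"
    proof (rule AE_I2)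
      fix t assume "t \<in> space unit_interval_measure"
      then have "\<bar>a t - K * psi k t\<bar> \<le> ?R t" by (intro bound) (simp add: space_restrict_space)
      then show "norm (a t - K * psi k t) \<le> norm (?R t)" by simp
    qed
  qed (use iKp in measurable)
  from Bochner_Integration.integrable_add[OF id iKp] show ia: "integrable unit_interval_measure a"
    by simp
  have "\<bar>(LINT t|unit_interval_measure. a t) - K\<bar> = \<bar>LINT t|unit_interval_measure. a t - K * psi k t\<bar>"
    using ia iKp by (simp add: integral_psi)
  also have "\<dots> \<le> (LINT t|unit_interval_measure. ?R t)"
  proof (rule order.trans[OF integral_abs_bound], rule integral_mono)
    show "\<bar>a t - K * psi k t\<bar> \<le> ?R t" if "t \<in> space unit_interval_measure" for t
      using that by (intro bound) (simp add: space_restrict_space)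
  qed (use id iR in auto)
  also have "\<dots> = (\<Sum>j\<le>k. M * (2/3)^j * (LINT t|unit_interval_measure. \<bar>psi (k - j) t - psi k t\<bar>))
      + 3 * M * (2/3)^k + C * (1/2)^Suc k"
    using integral_power_psi(2)[of 1 k] by (simp add: integrable_psi integral_psi itp)
  also have "\<dots> \<le> (\<Sum>j\<le>k. M * (2/3)^j * (real (j * (j + 1)) / sqrt k))
      + 3 * M * (quad_geom / sqrt k) + C * (1 / sqrt k)"
  proof (intro add_mono sum_mono mult_left_mono psi_L1_dist)
    have sk: "sqrt k \<le> real k" "sqrt k > 0"
      using k by (auto intro: real_le_lsqrt simp: power2_eq_square)
    \<comment> \<open>A single term of the series \<open>quad_geom\<close>, so that the tail (2/3)^k
      is bounded without a new constant.\<close>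
    have "(2/3::real)^k * real (k * (k + 1)) = (\<Sum>j\<in>{k}. (2/3) ^ j * real (j * (j + 1)))" by simp
    also have "\<dots> \<le> quad_geom"
      unfolding quad_geom_def by (intro sum_le_suminf summable_quad_geom) auto
    finally have "(2/3::real)^k * real (k * (k + 1)) \<le> quad_geom" .
    moreover have "sqrt k \<le> real (k * (k + 1))"
      by (rule order.trans[OF sk(1)]) (simp only: of_nat_le_iff, simp)
    then have "(2/3::real)^k * sqrt k \<le> (2/3)^k * real (k * (k + 1))"
      by (rule mult_left_mono) simp
    ultimately have "(2/3::real)^k * sqrt k \<le> quad_geom" by linarith
    then show "(2/3) ^ k \<le> quad_geom / sqrt k" using sk by (simp add: field_simps)
    have "real k < 2^k" by (rule of_nat_less_two_power)
    moreover have "(2::real)^k \<le> 2^Suc k" by simp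
    ultimately have "real k < 2^Suc k" by linarith
    then have "sqrt k \<le> 2^Suc k" using sk by linarith
    then show "(1 / 2) ^ Suc k \<le> 1 / sqrt k" using sk by (simp add: field_simps)
  qed (use k M C in auto)
  also have "(\<Sum>j\<le>k. M * (2/3)^j * (real (j * (j + 1)) / sqrt k))
      = M / sqrt k * (\<Sum>j\<le>k. (2/3)^j * real (j * (j + 1)))"
    by (simp add: sum_distrib_left mult_ac)
  also have "\<dots> \<le> M / sqrt k * quad_geom"
    unfolding quad_geom_def using M
    by (intro mult_left_mono sum_le_suminf summable_quad_geom) auto
  finally show "\<bar>(LINT t|unit_interval_measure. a t) - K\<bar> \<le> (4 * M * quad_geom + C) / sqrt k"
    by (simp add: algebra_simps add_divide_distrib)
qed

section \<open>Power series with given logarithmic derivative\<close>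

unbundle no vec_syntax
unbundle fps_syntax

text \<open>Each of the first \<open>nat \<lceil>3 * C\<rceil>\<close> steps of the recurrence in
  \<open>growth_bound\<close> may cost a factor 1 + C beyond the geometric rate; later steps cost
  nothing extra.\<close>

definition growth_const :: "real \<Rightarrow> real" where
  "growth_const C = (1 + C) ^ nat \<lceil>3 * C\<rceil>"

text \<open>A discrete Gronwall argument. With d i = 2^i c i, the hypothesis says i d i <= C S i, so
  the partial sums S grow by a factor of at most 1 + C/i per step. Once i >= 3 C this factor is at
  most 4/3, and undoing the scaling turns 4/3 into 2/3.\<close>

lemma growth_bound:
  fixes C :: real and c :: "nat \<Rightarrow> real"
  assumes "C \<ge> 0" and c: "\<And>i. 0 \<le> c i" "c 0 \<le> 1"
    and rec: "\<And>i. real i * c i \<le> C * (\<Sum>l=1..i. (1/2)^l * c (i - l))"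
  shows "c j \<le> growth_const C * (2/3)^j"
proof -
  define J where "J = nat \<lceil>3 * C\<rceil>"
  have J: "3 * C \<le> real J" unfolding J_def by linarith
  define d where "d i = c i * 2^i" for i
  define S where "S i = (\<Sum>l<i. d l)" for i
  have d0: "d i \<ge> 0" for i using c by (simp add: d_def)
  have S0: "S i \<ge> 0" for i unfolding S_def by (intro sum_nonneg d0)
  have dS: "real i * d i \<le> C * S i" for i
  proof -
    have "real i * d i = (real i * c i) * 2^i" by (simp add: d_def)
    also have "\<dots> \<le> (C * (\<Sum>l=1..i. (1/2)^l * c (i - l))) * 2^i"
      by (intro mult_right_mono rec) auto
    also have "\<dots> = C * (\<Sum>l=1..i. d (i - l))"
    proof -
      have "(1/2)^l * c (i - l) * 2^i = d (i - l)" if "l \<in> {1..i}" for l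
      proof -
        have "(2::real)^i = 2^(i-l) * 2^l" using that by (simp flip: power_add)
        then show ?thesis by (simp add: d_def power_one_over)
      qed
      then show ?thesis by (simp add: sum_distrib_right mult.assoc)
    qed
    also have "(\<Sum>l=1..i. d (i - l)) = S i"
      unfolding S_def
      by (rule sum.reindex_bij_witness[where i = "\<lambda>l. i - l" and j = "\<lambda>l. i - l"]) auto
    finally show ?thesis .
  qed
  have S_bd: "S (Suc i) \<le> (1 + C)^(min i J) * (4/3)^i" for i
  proof (induction i)
    case 0
    then show ?case using c by (simp add: S_def d_def)
  next
    case (Suc i)
    have "S (Suc (Suc i)) = S (Suc i) + d (Suc i)" by (simp add: S_def)
    also have "d (Suc i) \<le> C / real (Suc i) * S (Suc i)"
      using dS[of "Suc i"] by (simp add: field_simps)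
    also have "S (Suc i) + C / real (Suc i) * S (Suc i) = (1 + C / real (Suc i)) * S (Suc i)"
      by (simp add: algebra_simps)
    also have "\<dots> \<le> (1 + C / real (Suc i)) * ((1 + C)^(min i J) * (4/3)^i)"
      using assms by (intro mult_left_mono Suc) auto
    also have "\<dots> \<le> (1 + C)^(min (Suc i) J) * (4/3)^(Suc i)"
    proof (cases "i < J")
      case True
      have "1 + C / real (Suc i) \<le> 1 + C" using assms by (simp add: field_simps)
      also have "\<dots> \<le> (1 + C) * (4/3)" using assms by simp
      finally have "(1 + C / real (Suc i)) * ((1 + C)^i * (4/3)^i)
          \<le> ((1 + C) * (4/3)) * ((1 + C)^i * (4/3)^i)"
        by (rule mult_right_mono) (use assms in auto)
      then show ?thesis using True by (simp add: min_def algebra_simps)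
    next
      case False
      then have "3 * C \<le> real (Suc i)" using J by simp
      then have "1 + C / real (Suc i) \<le> 4/3" by (simp add: field_simps)
      then have "(1 + C / real (Suc i)) * ((1 + C)^J * (4/3)^i)
          \<le> (4/3) * ((1 + C)^J * (4/3)^i)"
        by (rule mult_right_mono) (use assms in auto)
      moreover have "min i J = J" "min (Suc i) J = J" using False by auto
      moreover have "(1 + C)^J * (4/3)^Suc i = (4/3) * ((1 + C)^J * (4/3)^i)" by simp
      ultimately show ?thesis by (simp only:)
    qed
    finally show ?case by simp
  qed
  have "d j \<le> S (Suc j)" using S0[of j] by (simp add: S_def)
  also have "\<dots> \<le> (1 + C)^(min j J) * (4/3)^j" by (rule S_bd)
  also have "\<dots> \<le> (1 + C)^J * (4/3)^j"
    using assms by (intro mult_right_mono power_increasing) auto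
  finally have "c j \<le> (1 + C)^J * (4/3)^j / 2^j" by (simp add: d_def field_simps)
  also have "\<dots> = (1 + C)^J * (2/3)^j"
  proof -
    have "(4/3::real)^j = (2/3)^j * 2^j" by (simp flip: power_mult_distrib)
    then show ?thesis by simp
  qed
  finally show ?thesis by (simp only: growth_const_def J_def)
qed

text \<open>The relation A = exp B between power series is carried as the differential equation A' =
  B' A with \<open>A $ 0 = 1\<close>. Compared coefficient by coefficient, it is a recurrence of the
  shape of Newton's identities.\<close>

lemma log_deriv_nth:
  fixes A B :: "real fps"
  assumes "fps_deriv A = fps_deriv B * A"
  shows "real j * A $ j = (\<Sum>i=1..j. real i * B $ i * A $ (j - i))"
proof (cases j)
  case (Suc m)
  have "real j * A $ j = (fps_deriv A) $ m" by (simp add: Suc)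
  also have "\<dots> = (\<Sum>i=0..m. real (Suc i) * B $ (Suc i) * A $ (m - i))"
    by (simp add: assms fps_mult_nth)
  also have "\<dots> = (\<Sum>i=Suc 0..Suc m. real i * B $ i * A $ (j - i))"
    unfolding sum.shift_bounds_cl_Suc_ivl by (simp add: Suc)
  finally show ?thesis by (simp add: Suc)
qed simp

lemma log_derivI:
  fixes A B :: "real fps"
  assumes "\<And>j. real j * A $ j = (\<Sum>i=1..j. real i * B $ i * A $ (j - i))"
  shows "fps_deriv A = fps_deriv B * A"
proof (rule fps_ext)
  fix m
  have "(fps_deriv A) $ m = real (Suc m) * A $ Suc m" by simp
  also have "\<dots> = (\<Sum>i=Suc 0..Suc m. real i * B $ i * A $ (Suc m - i))"
    by (subst assms) simp
  also have "\<dots> = (fps_deriv B * A) $ m"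
    unfolding sum.shift_bounds_cl_Suc_ivl by (simp add: fps_mult_nth)
  finally show "fps_deriv A $ m = (fps_deriv B * A) $ m" .
qed

lemma log_deriv_growth:
  fixes A B :: "real fps"
  assumes "C \<ge> 0" and A: "fps_deriv A = fps_deriv B * A" "A $ 0 = 1"
    and B: "\<And>i. i \<ge> 1 \<Longrightarrow> \<bar>real i * B $ i\<bar> \<le> C * (1/2)^i"
  shows "\<bar>A $ j\<bar> \<le> growth_const C * (2/3)^j"
proof (rule growth_bound[where c = "\<lambda>j. \<bar>A $ j\<bar>"])
  fix i
  have "real i * \<bar>A $ i\<bar> = \<bar>real i * A $ i\<bar>" by (simp add: abs_mult)
  also have "\<dots> \<le> (\<Sum>l=1..i. \<bar>real l * B $ l * A $ (i - l)\<bar>)"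
    unfolding log_deriv_nth[OF A(1)] by (rule sum_abs)
  also have "\<dots> \<le> (\<Sum>l=1..i. C * (1/2)^l * \<bar>A $ (i - l)\<bar>)"
    by (subst abs_mult, intro sum_mono mult_right_mono B) auto
  finally show "real i * \<bar>A $ i\<bar> \<le> C * (\<Sum>l=1..i. (1/2)^l * \<bar>A $ (i - l)\<bar>)"
    by (simp add: sum_distrib_left mult_ac)
qed (use assms in auto)

lemma summable_of_geometric_bound:
  fixes a :: "nat \<Rightarrow> real"
  assumes "\<And>j. \<bar>a j\<bar> \<le> M * r ^ j" "0 \<le> r" "r < 1"
  shows "summable (\<lambda>j. \<bar>a j\<bar>)"
  by (rule summable_comparison_test'[where g = "\<lambda>j. M * r ^ j" and N = 0])
     (use assms in \<open>auto intro!: summable_mult summable_geometric\<close>)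

lemma conv_radius_of_geometric_bound:
  fixes A :: "real fps"
  assumes "\<And>j. \<bar>A $ j\<bar> \<le> M * (2/3)^j"
  shows "fps_conv_radius A > 1"
proof -
  \<comment> \<open>5/4 is a point strictly between 1 and 3/2, the radius that the bound
    guarantees.\<close>
  have "summable (\<lambda>j. A $ j * (5/4)^j)"
  proof (rule summable_rabs_cancel, rule summable_of_geometric_bound)
    show "\<bar>A $ j * (5/4)^j\<bar> \<le> M * (5/6)^j" for j
    proof -
      have "\<bar>A $ j * (5/4)^j\<bar> \<le> M * (2/3)^j * (5/4)^j"
        using mult_right_mono[OF assms, of "(5/4)^j" j] by (simp add: abs_mult)
      also have "\<dots> = M * (5/6)^j"
        by (simp add: mult.assoc flip: power_mult_distrib)
      finally show ?thesis .
    qed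
  qed auto
  then have "conv_radius (fps_nth A) \<ge> norm (5/4::real)"
    by (rule conv_radius_geI)
  moreover have "ereal (norm (5/4::real)) > 1" by simp
  ultimately show ?thesis unfolding fps_conv_radius_def using less_le_trans by blast
qed

text \<open>Both series converge on a disc strictly larger than the unit disc, so z = 1 is an
  interior point. The differential equation makes A(z) exp(-B(z)) constant on [0,1], with value 1 at
  z = 0.\<close>

lemma log_deriv_sums:
  fixes A B :: "real fps"
  assumes A: "fps_deriv A = fps_deriv B * A" "A $ 0 = 1" and B0: "B $ 0 = 0"
    and B: "\<And>i. i \<ge> 1 \<Longrightarrow> \<bar>real i * B $ i\<bar> \<le> C * (1/2)^i"
  shows "summable (\<lambda>j. \<bar>A $ j\<bar>)" "summable (fps_nth B)" "fps_nth A sums exp (\<Sum>i. B $ i)"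
proof -
  have C: "C \<ge> 0" using B[of 1] by (simp add: abs_le_iff)
  note M = log_deriv_growth[OF C A B]
  show "summable (\<lambda>j. \<bar>A $ j\<bar>)" by (rule summable_of_geometric_bound[OF M]) auto
  \<comment> \<open>The rate is relaxed from 1/2 to 2/3 so that
    \<open>conv_radius_of_geometric_bound\<close> covers \<open>B\<close> as well as
    \<open>A\<close>.\<close>
  have B': "\<bar>B $ i\<bar> \<le> C * (2/3)^i" for i
  proof (cases "i = 0")
    case False
    have "\<bar>B $ i\<bar> \<le> real i * \<bar>B $ i\<bar>" using False by (simp add: mult_le_cancel_right1)
    also have "\<dots> = \<bar>real i * B $ i\<bar>" by (simp add: abs_mult)
    also have "\<dots> \<le> C * (1/2)^i" using False by (intro B) auto
    also have "\<dots> \<le> C * (2/3)^i" using C by (intro mult_left_mono power_mono) auto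
    finally show ?thesis .
  qed (use B0 C in auto)
  show "summable (fps_nth B)"
    by (rule summable_rabs_cancel, rule summable_of_geometric_bound[OF B']) auto
  have rA: "fps_conv_radius A > 1" by (rule conv_radius_of_geometric_bound[OF M])
  have rB: "fps_conv_radius B > 1" by (rule conv_radius_of_geometric_bound[OF B'])
  have inA: "z \<in> eball 0 (fps_conv_radius A)" and inB: "z \<in> eball 0 (fps_conv_radius B)"
    if "z \<in> {0..1}" for z :: real
  proof -
    have "ereal (dist 0 z) \<le> 1" using that by simp
    from le_less_trans[OF this rA] le_less_trans[OF this rB]
    show "z \<in> eball 0 (fps_conv_radius A)" "z \<in> eball 0 (fps_conv_radius B)"
      by simp_all
  qed
  define F where "F z = eval_fps A z * exp (- eval_fps B z)" for z
  have dF: "(F has_real_derivative 0) (at z)" if z: "z \<in> {0..1}" for z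
  proof -
    have "eval_fps (fps_deriv A) z = eval_fps (fps_deriv B) z * eval_fps A z"
    proof -
      have "norm z < fps_conv_radius (fps_deriv B)" "norm z < fps_conv_radius A"
        using inA[OF z] inB[OF z] fps_conv_radius_deriv[of B] by (auto simp: dist_norm intro: less_le_trans)
      then show ?thesis unfolding A(1) by (rule eval_fps_mult)
    qed
    moreover have "(eval_fps A has_field_derivative eval_fps (fps_deriv A) z) (at z)"
      "(eval_fps B has_field_derivative eval_fps (fps_deriv B) z) (at z)"
      using inA[OF z] inB[OF z] by (auto intro!: has_field_derivative_eval_fps simp: dist_norm)
    ultimately show ?thesis unfolding F_def
      by (auto intro!: derivative_eq_intros simp: algebra_simps)
  qed
  have "continuous_on {0..1} F"
    by (rule continuous_at_imp_continuous_on) (auto intro!: DERIV_isCont dF)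
  then have "F 1 = F 0"
    by (intro DERIV_isconst2[of 0 1 F 1]) (use dF in auto)
  then have "eval_fps A 1 = exp (eval_fps B 1)"
    using A(2) B0 by (simp add: F_def eval_fps_at_0 exp_minus field_simps)
  moreover have "(\<lambda>n. A $ n * 1 ^ n) sums eval_fps A 1"
    using inA[of 1] by (intro sums_eval_fps) (auto simp: dist_norm)
  ultimately show "fps_nth A sums exp (\<Sum>i. B $ i)"
    by (simp only: eval_fps_def power_one mult_1_right)
qed

section \<open>Dirichlet series over almost primes\<close>

lemma prime_Omega_mult: "m \<noteq> 0 \<Longrightarrow> n \<noteq> 0 \<Longrightarrow> prime_Omega (m * n) = prime_Omega m + prime_Omega n"
  by (simp add: prime_Omega_def prime_factorization_mult)

lemma prime_Omega_prime: "prime p \<Longrightarrow> prime_Omega p = 1"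
  by (simp add: prime_Omega_def prime_factorization_prime)

lemma prime_Omega_eq_sum: "prime_Omega n = (\<Sum>p\<in>prime_factors n. multiplicity p n)"
  unfolding prime_Omega_def size_multiset_overloaded_eq
  by (intro sum.cong refl) (auto simp: count_prime_factorization_prime in_prime_factors_imp_prime)

lemma multiplicity_le_prime_Omega:
  assumes "prime p"
  shows "multiplicity p n \<le> prime_Omega n"
proof (cases "p \<in> prime_factors n")
  case True
  then show ?thesis unfolding prime_Omega_eq_sum by (intro member_le_sum) auto
next
  case False
  then have "multiplicity p n = 0"
    using assms by (metis count_prime_factorization_prime not_in_iff)
  then show ?thesis by simp
qed

text \<open>Used to get log n >= k log 2 on \<open>almost_primes k\<close>, which makes the
  contribution of s > 2 small.\<close>

lemma two_power_prime_Omega_le: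
  assumes "n \<ge> 1"
  shows "2 ^ prime_Omega n \<le> n"
proof -
  have "2 ^ prime_Omega n = (\<Prod>p\<in>prime_factors n. 2 ^ multiplicity p n)"
    by (simp add: prime_Omega_eq_sum power_sum)
  also have "\<dots> \<le> (\<Prod>p\<in>prime_factors n. p ^ multiplicity p n)"
    by (intro prod_mono conjI power_mono) (auto dest: in_prime_factors_imp_prime prime_ge_2_nat)
  also have "\<dots> = n" using assms prod_prime_factors[of n] by simp
  finally show ?thesis .
qed

text \<open>The summand at n = 0 is 0, since \<open>0 powr x = 0\<close>, so this is the Riemann
  zeta function for s > 1.\<close>

definition nat_zeta :: "real \<Rightarrow> real" where
  "nat_zeta s = (\<Sum>\<^sub>\<infinity>n. real n powr - s)"

definition prime_zeta :: "real \<Rightarrow> real" where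
  "prime_zeta s = (\<Sum>\<^sub>\<infinity>p\<in>{p. prime p}. real p powr - s)"

lemma has_sum_sum:
  fixes f :: "'i \<Rightarrow> 'a \<Rightarrow> real"
  assumes "\<And>i. i \<in> I \<Longrightarrow> (f i has_sum S i) A"
  shows "((\<lambda>x. \<Sum>i\<in>I. f i x) has_sum (\<Sum>i\<in>I. S i)) A"
  using assms by (induction I rule: infinite_finite_induct) (auto intro: has_sum_0 has_sum_add)

lemma summable_on_powr: "s > 1 \<Longrightarrow> (\<lambda>n. real n powr - s) summable_on A"
proof -
  assume "s > 1"
  then have "(\<lambda>n. real n powr - s) summable_on UNIV"
    by (subst summable_on_UNIV_nonneg_real_iff) (auto simp: summable_real_powr_iff)
  then show ?thesis by (rule summable_on_subset_banach) simp
qed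

lemma summable_on_powr_bound:
  assumes "s > 1" "\<And>n. n \<in> A \<Longrightarrow> 0 \<le> f n" "\<And>n. n \<in> A \<Longrightarrow> f n \<le> c * real n powr - s"
  shows "f summable_on A"
  by (rule summable_on_comparison_test[OF summable_on_cmult_right[OF summable_on_powr[OF assms(1)]]])
     (use assms in auto)

lemma nat_zeta_sums: "s > 1 \<Longrightarrow> (\<lambda>n. real (Suc n) powr - s) sums nat_zeta s"
proof -
  assume "s > 1"
  then have "((\<lambda>n. real n powr - s) has_sum nat_zeta s) UNIV"
    unfolding nat_zeta_def by (intro has_sum_infsum summable_on_powr)
  then have "(\<lambda>n. real n powr - s) sums nat_zeta s" by (rule has_sum_imp_sums)
  then show ?thesis by (subst sums_Suc_iff) simp
qed

lemma nat_zeta_ge_1: "s > 1 \<Longrightarrow> nat_zeta s \<ge> 1"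
proof -
  assume "s > 1"
  from nat_zeta_sums[OF this] have "summable (\<lambda>n. real (Suc n) powr - s)"
    "nat_zeta s = (\<Sum>n. real (Suc n) powr - s)" by (auto simp: sums_iff)
  then show ?thesis using sum_le_suminf[of "\<lambda>n. real (Suc n) powr - s" "{0}"] by simp
qed

text \<open>Comparison with the integral of x^(-1-t), in telescoped form: by the mean value theorem,
  each difference of consecutive values of \<open>F\<close> lies between two neighbouring terms of
  the series, and the differences sum to F(1) = 1/t.\<close>

lemma nat_zeta_bounds:
  assumes t: "t > 0"
  shows "1 / t \<le> nat_zeta (1 + t)" "nat_zeta (1 + t) \<le> 1 + 1 / t"
proof -
  define F where "F x = x powr - t / t" for x :: real
  have step: "real (Suc (Suc n)) powr - (1 + t) \<le> F (Suc n) - F (Suc (Suc n))"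
    "F (Suc n) - F (Suc (Suc n)) \<le> real (Suc n) powr - (1 + t)" for n
  proof -
    have "\<exists>z. real (Suc n) < z \<and> z < real (Suc (Suc n)) \<and>
        F (Suc (Suc n)) - F (Suc n) = (real (Suc (Suc n)) - real (Suc n)) * (- (z powr - (1 + t)))"
    proof (rule MVT2)
      fix x :: real assume "real (Suc n) \<le> x" "x \<le> real (Suc (Suc n))"
      then have "x > 0" by linarith
      then have "(F has_real_derivative (- t * x powr (- t - 1)) / t) (at x)"
        unfolding F_def[abs_def] using t by (auto intro!: derivative_eq_intros)
      moreover have "- t - 1 = - (1 + t)" by simp
      ultimately show "(F has_real_derivative - (x powr - (1 + t))) (at x)"
        using t by simp
    qed simp
    then obtain z where z: "real (Suc n) < z" "z < real (Suc (Suc n))"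
      "F (Suc n) - F (Suc (Suc n)) = z powr - (1 + t)" by auto
    show "real (Suc (Suc n)) powr - (1 + t) \<le> F (Suc n) - F (Suc (Suc n))"
      unfolding z(3) by (rule powr_mono2') (use z t in auto)
    show "F (Suc n) - F (Suc (Suc n)) \<le> real (Suc n) powr - (1 + t)"
      unfolding z(3) by (rule powr_mono2') (use z t in auto)
  qed
  have "(\<lambda>n. real (Suc n) powr - t) \<longlonglongrightarrow> 0"
    by (rule tendsto_neg_powr[OF _ filterlim_compose[OF filterlim_real_sequentially filterlim_Suc]]) (use t in auto)
  then have "(\<lambda>n. F (Suc n)) \<longlonglongrightarrow> 0 / t" unfolding F_def by (intro tendsto_intros) (use t in auto)
  from telescope_sums'[OF this] have F: "(\<lambda>n. F (Suc n) - F (Suc (Suc n))) sums (1 / t)"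
    by (simp add: F_def)
  have z: "(\<lambda>n. real (Suc n) powr - (1 + t)) sums nat_zeta (1 + t)"
    using t by (intro nat_zeta_sums) auto
  show "1 / t \<le> nat_zeta (1 + t)" by (rule sums_le[OF step(2) F z])
  have "(\<lambda>n. real (Suc (Suc n)) powr - (1 + t)) sums (nat_zeta (1 + t) - 1)"
    using z by (subst sums_Suc_iff) simp
  from sums_le[OF step(1) this F] show "nat_zeta (1 + t) \<le> 1 + 1 / t" by linarith
qed

lemma prime_zeta_nonneg: "prime_zeta s \<ge> 0"
  unfolding prime_zeta_def by (intro infsum_nonneg) auto

text \<open>Of the i factors 1/p, two are kept for convergence and the other i - 2 are bounded by
  1/2 each. This is why i = 1 must be excluded and why the bound is uniform down to s = 1.\<close>

lemma prime_zeta_multiple_bound: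
  assumes "s \<ge> 1" "i \<ge> 2"
  shows "prime_zeta (real i * s) \<le> 4 * nat_zeta 2 * (1/2) ^ i"
proof -
  have is1: "real i * s > 1"
  proof -
    have "1 < real i * 1" using assms by simp
    also have "\<dots> \<le> real i * s" using assms by (intro mult_left_mono) auto
    finally show ?thesis .
  qed
  have "prime_zeta (real i * s) \<le> (\<Sum>\<^sub>\<infinity>n\<in>UNIV. 4 * (1/2)^i * real n powr - 2)"
    unfolding prime_zeta_def
  proof (rule infsum_mono_neutral)
    fix p :: nat assume "p \<in> {p. prime p} \<inter> UNIV"
    then have p: "real p \<ge> 2" using prime_ge_2_nat by auto
    obtain j where j: "i = j + 2" using assms by (metis add.commute le_Suc_ex)
    have "real p powr - (real i * s) \<le> real p powr - real i"
      using p assms by (intro powr_mono) (auto simp: mult_le_cancel_left1)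
    also have "\<dots> = inverse (real p ^ i)" using p by (simp add: powr_minus powr_realpow)
    also have "\<dots> = (1 / real p) ^ j * (1 / real p ^ 2)"
      by (simp add: j power_add power_one_over inverse_eq_divide power2_eq_square)
    also have "\<dots> \<le> (1/2) ^ j * (1 / real p ^ 2)"
      using p by (intro mult_right_mono power_mono) (auto simp: field_simps)
    also have "\<dots> = 4 * (1/2) ^ i * real p powr - 2"
      using p by (simp add: j power_add powr_minus powr_numeral field_simps)
    finally show "real p powr - (real i * s) \<le> 4 * (1/2)^i * real p powr - 2" .
  qed (use is1 in \<open>auto intro!: summable_on_powr summable_on_cmult_right\<close>)
  also have "\<dots> = 4 * (1/2)^i * nat_zeta 2"
    unfolding nat_zeta_def by (rule infsum_cmult_right) (intro summable_on_powr, simp)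
  finally show ?thesis by (simp add: mult_ac)
qed

section \<open>Weighted Dirichlet series and Newton's identities\<close>

definition Omega_series :: "(nat \<Rightarrow> real) \<Rightarrow> nat \<Rightarrow> real \<Rightarrow> real" where
  "Omega_series w k s = (\<Sum>\<^sub>\<infinity>n\<in>almost_primes k. w n * real n powr - s)"

text \<open>The trivial weight satisfies the assumption below with \<open>\<sigma> = 1\<close>, and the squarefree indicator with
  \<open>\<sigma> = -1\<close>.\<close>

locale Omega_weight =
  fixes w :: "nat \<Rightarrow> real" and \<sigma> :: real
  assumes weight_nonneg: "w n \<ge> 0" and weight_le_1: "w n \<le> 1" and weight_1: "w 1 = 1"
    and sign: "\<bar>\<sigma>\<bar> = 1"
    and weight_prime_mult: "prime p \<Longrightarrow> m \<ge> 1 \<Longrightarrow>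
      w (p * m) * (real (multiplicity p m) + 1) = w m * (1 + \<sigma> * real (multiplicity p m))"
begin

lemma summable_weight:
  assumes "s > 1"
  shows "(\<lambda>n. w n * real n powr - s) summable_on A"
  by (rule summable_on_powr_bound[OF assms, where c = 1])
     (use weight_nonneg weight_le_1 in \<open>auto intro: mult_right_mono mult_left_le_one_le\<close>)

lemma Omega_series_0: "Omega_series w 0 s = 1"
proof -
  have "almost_primes 0 = {1}"
    by (auto simp: almost_primes_def prime_Omega_def prime_factorization_empty_iff)
  then show ?thesis using weight_1 by (simp add: Omega_series_def)
qed

lemma summable_multiplicity:
  assumes "s > 1" "prime p"
  shows "(\<lambda>n. w n * real (multiplicity p n) * real n powr - s) summable_on almost_primes k"
proof (rule summable_on_powr_bound[OF assms(1), where c = "real k"])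
  fix n assume "n \<in> almost_primes k"
  then have "real (multiplicity p n) \<le> real k"
    using multiplicity_le_prime_Omega[OF assms(2), of n] by (simp add: almost_primes_def)
  then have "w n * real (multiplicity p n) \<le> 1 * real k"
    using weight_nonneg weight_le_1 by (intro mult_mono) auto
  then show "w n * real (multiplicity p n) * real n powr - s \<le> real k * real n powr - s"
    by (intro mult_right_mono) auto
qed (use weight_nonneg in auto)

text \<open>Only multiples n = p m contribute. If p has multiplicity a in m, it has multiplicity a +
  1 in n, and the axiom \<open>weight_prime_mult\<close> turns w(p m) (a + 1) into w(m) (1 +
  \<sigma> a), so that the sum closes on itself with k lowered by one.\<close>

lemma multiplicity_series_Suc:
  assumes s: "s > 1" and p: "prime p"
  shows "(\<Sum>\<^sub>\<infinity>n\<in>almost_primes (Suc k). w n * real (multiplicity p n) * real n powr - s)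
    = real p powr - s * (Omega_series w k s
        + \<sigma> * (\<Sum>\<^sub>\<infinity>n\<in>almost_primes k. w n * real (multiplicity p n) * real n powr - s))"
proof -
  let ?f = "\<lambda>n. w n * real (multiplicity p n) * real n powr - s"
  have p0: "p \<noteq> 0" "p > 0" using p by (auto simp: prime_gt_0_nat)
  have sub: "(*) p ` almost_primes k \<subseteq> almost_primes (Suc k)"
    using p p0 by (auto simp: almost_primes_def prime_Omega_mult prime_Omega_prime)
  have "infsum ?f (almost_primes (Suc k)) = infsum ?f ((*) p ` almost_primes k)"
  proof (rule infsum_cong_neutral)
    fix n assume n: "n \<in> almost_primes (Suc k) - (*) p ` almost_primes k"
    have "\<not> p dvd n"
    proof
      assume "p dvd n"
      then obtain m where m: "n = p * m" by blast
      then have "m \<in> almost_primes k"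
        using n p p0 by (auto simp: almost_primes_def prime_Omega_mult prime_Omega_prime)
      then show False using n m by auto
    qed
    then show "?f n = 0" by (simp add: not_dvd_imp_multiplicity_0)
  qed (use sub in auto)
  also have "\<dots> = infsum (?f \<circ> (*) p) (almost_primes k)"
    by (rule infsum_reindex) (use p0 in \<open>auto simp: inj_on_def\<close>)
  also have "\<dots> = (\<Sum>\<^sub>\<infinity>n\<in>almost_primes k.
      real p powr - s * (w n * real n powr - s + \<sigma> * ?f n))"
  proof (rule infsum_cong)
    fix n assume n: "n \<in> almost_primes k"
    have "multiplicity p (p * n) = Suc (multiplicity p n)"
      using n p by (intro multiplicity_times_same) (auto simp: almost_primes_def prime_gt_1_nat)
    then have "(?f \<circ> (*) p) n = (w (p * n) * (real (multiplicity p n) + 1)) * (real p powr - s * real n powr - s)"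
      by (simp add: powr_mult algebra_simps)
    also have "\<dots> = real p powr - s * (w n * real n powr - s + \<sigma> * ?f n)"
      using n p by (subst weight_prime_mult) (auto simp: almost_primes_def algebra_simps)
    finally show "(?f \<circ> (*) p) n = real p powr - s * (w n * real n powr - s + \<sigma> * ?f n)" .
  qed
  also have "\<dots> = real p powr - s * (Omega_series w k s + \<sigma> * infsum ?f (almost_primes k))"
    unfolding Omega_series_def
    using summable_weight[OF s] summable_multiplicity[OF s p]
    by (simp add: infsum_cmult_right infsum_add summable_on_add summable_on_cmult_right)
  finally show ?thesis .
qed

lemma multiplicity_series:
  assumes s: "s > 1" and p: "prime p"
  shows "(\<Sum>\<^sub>\<infinity>n\<in>almost_primes k. w n * real (multiplicity p n) * real n powr - s)
    = (\<Sum>i<k. \<sigma> ^ i * Omega_series w (k - Suc i) s * real p powr - (real (Suc i) * s))"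
proof (induction k)
  case 0
  have "multiplicity p n = 0" if "n \<in> almost_primes 0" for n
    using multiplicity_le_prime_Omega[OF p, of n] that by (simp add: almost_primes_def)
  then show ?case by (simp add: infsum_0)
next
  case (Suc k)
  let ?T = "\<lambda>k i. \<sigma> ^ i * Omega_series w (k - Suc i) s * real p powr - (real (Suc i) * s)"
  have step: "real p powr - s * (\<sigma> * ?T k i) = ?T (Suc k) (Suc i)" for i
  proof -
    have "- (real (Suc (Suc i)) * s) = - s + - (real (Suc i) * s)" by (simp add: algebra_simps)
    then have "real p powr - (real (Suc (Suc i)) * s) = real p powr - s * real p powr - (real (Suc i) * s)"
      by (simp only: powr_add)
    then show ?thesis by simp
  qed
  have "real p powr - s * (Omega_series w k s + \<sigma> * (\<Sum>i<k. ?T k i))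
      = ?T (Suc k) 0 + (\<Sum>i<k. real p powr - s * (\<sigma> * ?T k i))"
    by (simp add: distrib_left sum_distrib_left)
  then show ?case
    unfolding multiplicity_series_Suc[OF s p] Suc.IH sum.lessThan_Suc_shift step .
qed

text \<open>Double counting: k = Omega(n) is the sum of the multiplicities of the primes in n. After
  the sums over n and p are exchanged, \<open>multiplicity_series\<close> leaves powers of p, which
  sum to prime zeta values.\<close>

lemma Omega_series_recurrence:
  assumes s: "s > 1"
  shows "real k * Omega_series w k s
    = (\<Sum>i=1..k. \<sigma> ^ (i - 1) * prime_zeta (real i * s) * Omega_series w (k - i) s)"
proof -
  let ?P = "{p::nat. prime p}"
  let ?g = "\<lambda>n p. w n * real (multiplicity p n) * real n powr - s"
  have inner: "((\<lambda>p. ?g n p) has_sum (real k * (w n * real n powr - s))) ?P"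
    if n: "n \<in> almost_primes k" for n
  proof -
    have "((\<lambda>p. ?g n p) has_sum (\<Sum>p\<in>prime_factors n. ?g n p)) (prime_factors n)"
      by (rule has_sum_finite) simp
    also have "?this \<longleftrightarrow> ((\<lambda>p. ?g n p) has_sum (\<Sum>p\<in>prime_factors n. ?g n p)) ?P"
    proof (rule has_sum_cong_neutral)
      fix p assume "p \<in> ?P - prime_factors n"
      then have "multiplicity p n = 0" by (metis DiffE count_prime_factorization_prime mem_Collect_eq not_in_iff)
      then show "?g n p = 0" by simp
    qed auto
    also have "(\<Sum>p\<in>prime_factors n. ?g n p) = real k * (w n * real n powr - s)"
      using n by (simp add: almost_primes_def prime_Omega_eq_sum flip: sum_distrib_left sum_distrib_right)
        (auto simp: mult_ac)
    finally show ?thesis .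
  qed
  have "real k * Omega_series w k s = (\<Sum>\<^sub>\<infinity>n\<in>almost_primes k. real k * (w n * real n powr - s))"
    unfolding Omega_series_def by (rule infsum_cmult_right[symmetric]) (rule summable_weight[OF s])
  also have "\<dots> = (\<Sum>\<^sub>\<infinity>n\<in>almost_primes k. \<Sum>\<^sub>\<infinity>p\<in>?P. ?g n p)"
    by (rule infsum_cong, rule infsumI[symmetric], rule inner)
  also have "\<dots> = (\<Sum>\<^sub>\<infinity>p\<in>?P. \<Sum>\<^sub>\<infinity>n\<in>almost_primes k. ?g n p)"
  proof (rule infsum_swap_banach, rule summable_on_SigmaI)
    show "(\<lambda>n. real k * (w n * real n powr - s)) summable_on almost_primes k"
      by (intro summable_on_cmult_right summable_weight s)
  qed (use inner weight_nonneg in auto)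
  also have "\<dots> = (\<Sum>\<^sub>\<infinity>p\<in>?P. \<Sum>i<k. \<sigma> ^ i * Omega_series w (k - Suc i) s * real p powr - (real (Suc i) * s))"
    by (rule infsum_cong) (use multiplicity_series[OF s] in auto)
  also have "\<dots> = (\<Sum>i<k. \<sigma> ^ i * Omega_series w (k - Suc i) s * prime_zeta (real (Suc i) * s))"
    unfolding prime_zeta_def
  proof (rule infsumI, rule has_sum_sum, rule has_sum_cmult_right, rule has_sum_infsum, rule summable_on_powr)
    fix i
    have "1 < 1 * s" using s by simp
    also have "\<dots> \<le> real (Suc i) * s" using s by (intro mult_right_mono) auto
    finally show "1 < real (Suc i) * s" .
  qed
  also have "\<dots> = (\<Sum>i=1..k. \<sigma> ^ (i - 1) * prime_zeta (real i * s) * Omega_series w (k - i) s)"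
    by (simp add: sum.atLeast1_atMost_eq mult_ac)
  finally show ?thesis .
qed

end

text \<open>The integers n >= 1 are sorted by Omega(n). Compared with the exponential formula for
  the same sum, this expresses log zeta(s) through the prime zeta function.\<close>

lemma Omega_series_one_sums:
  assumes s: "s > 1"
  shows "(\<lambda>k. Omega_series (\<lambda>_. 1) k s) sums nat_zeta s"
proof -
  have "((\<lambda>n. real n powr - s) has_sum nat_zeta s) UNIV"
    unfolding nat_zeta_def by (intro has_sum_infsum summable_on_powr s)
  also have "?this \<longleftrightarrow> ((\<lambda>n. real n powr - s) has_sum nat_zeta s) {1..}"
    by (rule has_sum_cong_neutral) (auto simp: not_le)
  also have "\<dots> \<longleftrightarrow> ((\<lambda>(k, n). real n powr - s) has_sum nat_zeta s) (Sigma UNIV almost_primes)"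
    by (rule has_sum_reindex_bij_witness[where i = snd and j = "\<lambda>n. (prime_Omega n, n)"])
       (auto simp: almost_primes_def)
  finally have "((\<lambda>k. Omega_series (\<lambda>_. 1) k s) has_sum nat_zeta s) UNIV"
    by (rule has_sum_SigmaD) (auto simp: Omega_series_def intro!: has_sum_infsum summable_on_powr s)
  then show ?thesis by (rule has_sum_imp_sums)
qed

section \<open>The generating function and its logarithm\<close>

context Omega_weight
begin

definition gen_fps :: "real \<Rightarrow> real fps" where
  "gen_fps s = Abs_fps (\<lambda>k. Omega_series w k s)"

text \<open>The summand for \<open>i = 0\<close> is 0, since it is a division by 0.\<close>

definition log_fps :: "real \<Rightarrow> real fps" where
  "log_fps s = Abs_fps (\<lambda>i. \<sigma> ^ (i - 1) * prime_zeta (real i * s) / real i)"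

lemma gen_fps_nth_0: "gen_fps s $ 0 = 1"
  by (simp add: gen_fps_def Omega_series_0)

lemma fps_deriv_gen_fps:
  assumes "s > 1"
  shows "fps_deriv (gen_fps s) = fps_deriv (log_fps s) * gen_fps s"
proof (rule log_derivI)
  fix j
  show "real j * gen_fps s $ j = (\<Sum>i=1..j. real i * log_fps s $ i * gen_fps s $ (j - i))"
    unfolding gen_fps_def log_fps_def fps_nth_Abs_fps Omega_series_recurrence[OF assms]
    by (intro sum.cong) auto
qed

lemma abs_log_fps: "\<bar>real i * log_fps s $ i\<bar> = (if i = 0 then 0 else prime_zeta (real i * s))"
  using prime_zeta_nonneg[of "real i * s"] sign by (simp add: log_fps_def abs_mult power_abs)

lemma log_fps_bound:
  assumes "s \<ge> 1" "i \<ge> 2"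
  shows "\<bar>real i * log_fps s $ i\<bar> \<le> 4 * nat_zeta 2 * (1/2) ^ i"
  using prime_zeta_multiple_bound[OF assms] assms by (simp add: abs_log_fps)

text \<open>The constant depends on s and is unbounded as s tends to 1, so this serves for
  convergence at fixed s. Uniform bounds come only after the term i = 1 has been
  compensated.\<close>

lemma log_fps_bound':
  assumes "s > 1" "i \<ge> 1"
  shows "\<bar>real i * log_fps s $ i\<bar> \<le> (4 * nat_zeta 2 + 2 * prime_zeta s) * (1/2) ^ i"
proof (cases "i = 1")
  case True
  then show ?thesis using nat_zeta_ge_1[of 2] abs_log_fps[of 1 s] by simp
next
  case False
  then have "\<bar>real i * log_fps s $ i\<bar> \<le> 4 * nat_zeta 2 * (1/2) ^ i"
    using assms by (intro log_fps_bound) auto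
  also have "\<dots> \<le> (4 * nat_zeta 2 + 2 * prime_zeta s) * (1/2) ^ i"
    using prime_zeta_nonneg by (intro mult_right_mono) auto
  finally show ?thesis .
qed

lemma Omega_series_sums:
  assumes "s > 1"
  shows "summable (\<lambda>k. \<bar>Omega_series w k s\<bar>)" "summable (fps_nth (log_fps s))"
    "(\<lambda>k. Omega_series w k s) sums exp (\<Sum>i. log_fps s $ i)"
proof -
  have nth: "fps_nth (gen_fps s) = (\<lambda>k. Omega_series w k s)" and "log_fps s $ 0 = 0"
    by (auto simp: gen_fps_def log_fps_def)
  from log_deriv_sums[OF fps_deriv_gen_fps[OF assms] gen_fps_nth_0 this(2) log_fps_bound'[OF assms]]
  show "summable (\<lambda>k. \<bar>Omega_series w k s\<bar>)" "summable (fps_nth (log_fps s))"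
    "(\<lambda>k. Omega_series w k s) sums exp (\<Sum>i. log_fps s $ i)"
    unfolding nth by simp_all
qed

text \<open>The bounds 4 zeta(2) 2^(-i) are summed over i >= 2, giving away the division by
  i.\<close>

lemma suminf_log_fps:
  assumes s: "s > 1"
  shows "\<bar>(\<Sum>i. log_fps s $ i) - prime_zeta s\<bar> \<le> 2 * nat_zeta 2"
proof -
  have "(\<Sum>i. log_fps s $ i) = (\<Sum>i. log_fps s $ (i + 2)) + (\<Sum>i<2. log_fps s $ i)"
    by (rule suminf_split_initial_segment) (rule Omega_series_sums[OF s])
  also have "(\<Sum>i<2. log_fps s $ i) = prime_zeta s"
    by (simp add: log_fps_def numeral_2_eq_2)
  finally have eq: "(\<Sum>i. log_fps s $ i) - prime_zeta s = (\<Sum>i. log_fps s $ (i + 2))" by simp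
  have geo: "(\<lambda>i. nat_zeta 2 * (1/2)^i) sums (nat_zeta 2 * (1 / (1 - 1/2)))"
    by (intro sums_mult geometric_sums) auto
  have "norm (log_fps s $ (i + 2)) \<le> nat_zeta 2 * (1/2)^i" for i
  proof -
    have "\<bar>log_fps s $ (i + 2)\<bar> \<le> real (i + 2) * \<bar>log_fps s $ (i + 2)\<bar>"
      by (simp add: mult_le_cancel_right1)
    also have "\<dots> = \<bar>real (i + 2) * log_fps s $ (i + 2)\<bar>" by (simp add: abs_mult)
    also have "\<dots> \<le> 4 * nat_zeta 2 * (1/2) ^ (i + 2)" using s by (intro log_fps_bound) auto
    finally show ?thesis by (simp add: power_add power2_eq_square)
  qed
  from norm_suminf_le[OF this sums_summable[OF geo]] geo show ?thesis
    unfolding eq by (simp add: sums_iff)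
qed

end

section \<open>The two weights and their values at z = 1\<close>

interpretation one_weight: Omega_weight "\<lambda>_. 1" 1
  by unfold_locales auto

text \<open>Let a be the multiplicity of p in m. For a = 0 the identity says that p m and m are
  squarefree together; for a = 1 the factor 1 - a vanishes and p m is not squarefree; for a >= 2
  neither number is.\<close>

interpretation squarefree_weight: Omega_weight "\<lambda>n. of_bool (squarefree n)" "-1"
proof
  fix p m :: nat assume p: "prime p" and m: "m \<ge> 1"
  show "of_bool (squarefree (p * m)) * (real (multiplicity p m) + 1)
      = of_bool (squarefree m) * (1 + - 1 * real (multiplicity p m))"
  proof (cases "p dvd m")
    case True
    then have "\<not> squarefree (p * m)"
      using p by (intro not_squarefreeI[of p]) (auto simp: power2_eq_square)
    moreover have "multiplicity p m = 1" if "squarefree m"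
    proof -
      have "multiplicity p m \<le> 1" using that p m by (simp add: squarefree_factorial_semiring'')
      moreover have "multiplicity p m > 0" using True p m by (simp add: prime_multiplicity_gt_zero_iff)
      ultimately show ?thesis by simp
    qed
    ultimately show ?thesis by simp
  next
    case False
    then have "coprime p m" using p by (simp add: prime_imp_coprime)
    then have "squarefree (p * m) \<longleftrightarrow> squarefree m"
      using squarefree_mult_coprime squarefree_prime[OF p] squarefree_multD by blast
    then show ?thesis using False by (simp add: not_dvd_imp_multiplicity_0)
  qed
qed auto

lemma nat_zeta_eq_exp:
  assumes "s > 1"
  shows "summable (\<lambda>i. prime_zeta (real i * s) / real i)"
    "nat_zeta s = exp (\<Sum>i. prime_zeta (real i * s) / real i)"
proof -
  have "fps_nth (one_weight.log_fps s) = (\<lambda>i. prime_zeta (real i * s) / real i)"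
    by (auto simp: one_weight.log_fps_def)
  then show "summable (\<lambda>i. prime_zeta (real i * s) / real i)"
    "nat_zeta s = exp (\<Sum>i. prime_zeta (real i * s) / real i)"
    using one_weight.Omega_series_sums(2,3)[OF assms] sums_unique2[OF Omega_series_one_sums[OF assms]]
    by simp_all
qed

text \<open>The alternating series is the full one minus twice its even part. At i = 2 m, twice the
  term P(i s)/i is P(m (2 s))/m, so the part subtracted is log zeta(2 s). The terms at index 0
  vanish as divisions by 0.\<close>

lemma exp_squarefree_log:
  assumes s: "s > 1"
  shows "exp (\<Sum>i. squarefree_weight.log_fps s $ i) = nat_zeta s / nat_zeta (2 * s)"
proof -
  let ?f = "\<lambda>i. prime_zeta (real i * s) / real i"
  let ?e = "\<lambda>i. if even i then 2 * ?f i else 0"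
  define S where "S = (\<Sum>m. prime_zeta (real m * (2 * s)) / real m)"
  have "(\<lambda>m. prime_zeta (real m * (2 * s)) / real m) sums S"
    using nat_zeta_eq_exp(1)[of "2 * s"] s unfolding S_def by (intro summable_sums) auto
  also have "(\<lambda>m. prime_zeta (real m * (2 * s)) / real m) = (\<lambda>m. ?e (2 * m))"
    by (auto simp: mult_ac)
  finally have e: "?e sums S"
    by (subst (asm) sums_mono_reindex) (auto simp: strict_mono_def elim!: evenE)
  have f: "?f sums (\<Sum>i. ?f i)" by (intro summable_sums nat_zeta_eq_exp s)
  have "squarefree_weight.log_fps s $ i = ?f i - ?e i" for i
    by (cases i) (auto simp: squarefree_weight.log_fps_def)
  then have "(\<Sum>i. squarefree_weight.log_fps s $ i)
      = (\<Sum>i. ?f i) - S"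
    using sums_unique[OF sums_diff[OF f e]] by simp
  then show ?thesis
    using nat_zeta_eq_exp(2)[OF s] nat_zeta_eq_exp(2)[of "2 * s"] s by (simp add: exp_diff S_def)
qed

text \<open>The singularity of the prime zeta function is read off from zeta: log zeta(1 + t)
  differs from it by at most 2 zeta(2), and t zeta(1 + t) lies between 1 and 2.\<close>

lemma prime_zeta_near_1:
  assumes t: "0 < t" "t < 1"
  shows "\<bar>prime_zeta (1 + t) + ln t\<bar> \<le> 2 * nat_zeta 2 + ln 2"
proof -
  have s: "1 + t > 1" using t by simp
  let ?S = "\<Sum>i. one_weight.log_fps (1 + t) $ i"
  have "(\<lambda>k. Omega_series (\<lambda>_. 1) k (1 + t)) sums exp ?S" by (rule one_weight.Omega_series_sums[OF s])
  then have z: "nat_zeta (1 + t) = exp ?S" using Omega_series_one_sums[OF s] sums_unique2 by blast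
  have b: "1 \<le> t * nat_zeta (1 + t)" "t * nat_zeta (1 + t) \<le> 2"
    using nat_zeta_bounds[OF t(1)] t by (auto simp: field_simps)
  have "ln (t * nat_zeta (1 + t)) = ln t + ?S" using t unfolding z by (simp add: ln_mult)
  moreover have "0 \<le> ln (t * nat_zeta (1 + t))" using b(1) by (rule ln_ge_zero)
  moreover have "ln (t * nat_zeta (1 + t)) \<le> ln 2" using b by (intro ln_mono) auto
  ultimately have "0 \<le> ln t + ?S" "ln t + ?S \<le> ln 2" by simp_all
  then show ?thesis using one_weight.suminf_log_fps[OF s] by linarith
qed

section \<open>Integration over the exponent\<close>

lemma integral_nat_powr:
  assumes n: "n \<ge> 2"
  shows "integrable unit_interval_measure (\<lambda>t. real n powr - (1 + t))"
    "(LINT t|unit_interval_measure. real n powr - (1 + t)) = erdos_term n * (1 - 1 / real n)"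
proof -
  have ln: "ln (real n) > 0" using n by simp
  define F where "F t = - (real n powr - (1 + t)) / ln (real n)" for t
  have dF: "(F has_real_derivative real n powr - (1 + t)) (at t)" for t
    unfolding F_def[abs_def] using n ln by (auto intro!: derivative_eq_intros)
  have cF: "isCont F t" for t using dF by (rule DERIV_isCont)
  have "isCont (\<lambda>t. real n powr - (1 + t)) t" for t
    using n by (intro continuous_intros) auto
  moreover have "(F \<longlongrightarrow> F 0) (at_right 0)" "(F \<longlongrightarrow> F 1) (at_left 1)"
    using cF[of 0] cF[of 1] unfolding isCont_def by (auto intro: tendsto_within_subset)
  ultimately have "set_integrable lborel (einterval (ereal 0) (ereal 1)) (\<lambda>t. real n powr - (1 + t))"
    "(LBINT t=ereal 0..ereal 1. real n powr - (1 + t)) = F 1 - F 0"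
    using dF by (intro interval_integral_FTC_nonneg[where F = F] AE_I2; simp add: ereal_tendsto_simps)+
  moreover have "F 1 - F 0 = erdos_term n * (1 - 1 / real n)"
  proof -
    have "real n powr - 1 = 1 / real n" "real n powr - 2 = 1 / (real n * real n)"
      using n by (simp_all add: powr_minus_divide powr_numeral power2_eq_square)
    then show ?thesis using n ln by (simp add: F_def erdos_term_def field_simps)
  qed
  ultimately show "integrable unit_interval_measure (\<lambda>t. real n powr - (1 + t))"
    "(LINT t|unit_interval_measure. real n powr - (1 + t)) = erdos_term n * (1 - 1 / real n)"
    by (simp_all add: integrable_restrict_space integral_restrict_space set_integrable_def
      set_lebesgue_integral_def interval_lebesgue_integral_def)
qed

lemma almost_primes_ge_2: "n \<in> almost_primes k \<Longrightarrow> k \<ge> 1 \<Longrightarrow> n \<ge> 2"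
  by (cases "n = 1") (auto simp: almost_primes_def prime_Omega_def)

lemma erdos_term_nonneg: "n \<ge> 1 \<Longrightarrow> erdos_term n \<ge> 0"
  by (simp add: erdos_term_def)

context Omega_weight
begin

text \<open>An ordinary series over all naturals, the form needed for measurability in t and for
  exchanging sum and integral.\<close>

lemma Omega_series_nat_sums:
  assumes s: "s > 1"
  shows "(\<lambda>n. if n \<in> almost_primes k then w n * real n powr - s else 0) sums Omega_series w k s"
proof -
  have "((\<lambda>n. w n * real n powr - s) has_sum Omega_series w k s) (almost_primes k)"
    unfolding Omega_series_def by (intro has_sum_infsum summable_weight s)
  also have "?this \<longleftrightarrow> ((\<lambda>n. if n \<in> almost_primes k then w n * real n powr - s else 0)
      has_sum Omega_series w k s) UNIV"
    by (rule has_sum_cong_neutral) auto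
  finally show ?thesis by (rule has_sum_imp_sums)
qed

lemma measurable_Omega_series [measurable]:
  "(\<lambda>t. Omega_series w k (1 + t)) \<in> borel_measurable unit_interval_measure"
proof -
  have "(\<lambda>t. \<Sum>n. if n \<in> almost_primes k then w n * real n powr - (1 + t) else 0)
      \<in> borel_measurable unit_interval_measure"
    by (rule measurable_restrict_space1) measurable
  also have "?this \<longleftrightarrow> ?thesis"
    by (rule measurable_cong) (use Omega_series_nat_sums in \<open>auto simp: space_restrict_space sums_iff\<close>)
  finally show ?thesis .
qed

text \<open>Multiplying the generating function by \<open>exp (X ln t)\<close> cancels the singularity of \<open>prime_zeta\<close> at 1, so
  that the new coefficients decay geometrically, uniformly in \<open>t\<close>.\<close>

lemma integral_Omega_series:
  assumes K: "\<And>t. 0 < t \<Longrightarrow> t < 1 \<Longrightarrow> \<bar>t * exp (\<Sum>i. log_fps (1 + t) $ i) - K\<bar> \<le> C * t"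
    and k: "k \<ge> 1"
  defines "M \<equiv> growth_const (8 * nat_zeta 2 + 2 * ln 2)"
  shows "integrable unit_interval_measure (\<lambda>t. Omega_series w k (1 + t))"
    "\<bar>(LINT t|unit_interval_measure. Omega_series w k (1 + t)) - K\<bar> \<le> (4 * M * quad_geom + C) / sqrt k"
proof -
  define h where "h t = gen_fps (1 + t) * fps_exp (ln t)" for t
  have z2: "nat_zeta 2 \<ge> 1" by (rule nat_zeta_ge_1) simp
  have conv: "Omega_series w k (1 + t) = (\<Sum>j\<le>k. h t $ j * psi (k - j) t)" for t
  proof -
    \<comment> \<open>The coefficients of \<open>fps_exp (- ln t)\<close> are the functions
      \<open>psi m t\<close>.\<close>
    have "gen_fps (1 + t) = h t * fps_exp (- ln t)"
      by (simp add: h_def mult.assoc flip: fps_exp_add_mult)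
    then have "gen_fps (1 + t) $ k = (\<Sum>j\<le>k. h t $ j * psi (k - j) t)"
      by (simp add: fps_mult_nth psi_def atLeast0AtMost)
    then show ?thesis by (simp add: gen_fps_def)
  qed
  have bound: "\<bar>h t $ j\<bar> \<le> M * (2/3) ^ j" if t: "t \<in> {0<..<1}" for t j
    unfolding M_def
  \<comment> \<open>The factor exp(z ln t) changes the logarithm only at index 1, where P(1 + t) +
    ln t is bounded. The constant in \<open>M\<close> adds 4 zeta(2), for i >= 2, to twice the bound
    2 zeta(2) + ln 2 at i = 1; the doubling undoes (1/2)^1.\<close>
  proof (rule log_deriv_growth[where B = "log_fps (1 + t) + fps_const (ln t) * fps_X"])
    show "fps_deriv (h t) = fps_deriv (log_fps (1 + t) + fps_const (ln t) * fps_X) * h t"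
      using t by (simp add: h_def fps_deriv_gen_fps algebra_simps)
    show "h t $ 0 = 1" by (simp add: h_def fps_mult_nth gen_fps_nth_0)
    fix i :: nat assume i: "i \<ge> 1"
    show "\<bar>real i * (log_fps (1 + t) + fps_const (ln t) * fps_X) $ i\<bar>
        \<le> (8 * nat_zeta 2 + 2 * ln 2) * (1/2) ^ i"
    proof (cases "i = 1")
      case True
      have "(log_fps (1 + t) + fps_const (ln t) * fps_X) $ 1 = prime_zeta (1 + t) + ln t"
        by (simp add: log_fps_def)
      then show ?thesis using True prime_zeta_near_1[of t] t z2 by simp
    next
      case False
      then have "\<bar>real i * (log_fps (1 + t) + fps_const (ln t) * fps_X) $ i\<bar> = \<bar>real i * log_fps (1 + t) $ i\<bar>"
        by (simp add: fps_X_def)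
      also have "\<dots> \<le> 4 * nat_zeta 2 * (1/2) ^ i"
        using t i False by (intro log_fps_bound) auto
      also have "\<dots> \<le> (8 * nat_zeta 2 + 2 * ln 2) * (1/2) ^ i"
        using z2 by (intro mult_right_mono) auto
      finally show ?thesis .
    qed
  qed (use z2 in auto)
  \<comment> \<open>Evaluation at z = 1 by a Cauchy product; the factor t is exp(ln t).\<close>
  have sums: "(\<lambda>j. h t $ j) sums (t * exp (\<Sum>i. log_fps (1 + t) $ i))" if t: "t \<in> {0<..<1}" for t
  proof -
    have s: "1 + t > 1" using t by simp
    note G = Omega_series_sums[OF s]
    have e: "(\<lambda>n. fps_exp (ln t) $ n) sums exp (ln t)"
      using exp_converges[of "ln t"] by (simp add: scaleR_conv_of_real divide_inverse mult.commute)
    have "summable (\<lambda>n. norm (fps_exp (ln t) $ n))"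
      using summable_norm_exp[of "ln t"] by (simp add: divide_inverse abs_mult power_abs mult.commute)
    then have "(\<lambda>k. \<Sum>i\<le>k. Omega_series w i (1 + t) * fps_exp (ln t) $ (k - i))
        sums ((\<Sum>k. Omega_series w k (1 + t)) * (\<Sum>n. fps_exp (ln t) $ n))"
      using G(1) by (intro Cauchy_product_sums) auto
    also have "(\<lambda>k. \<Sum>i\<le>k. Omega_series w i (1 + t) * fps_exp (ln t) $ (k - i)) = (\<lambda>k. h t $ k)"
      by (simp add: h_def fps_mult_nth gen_fps_def atLeast0AtMost)
    finally show ?thesis using t G(3) e by (simp add: sums_iff mult.commute)
  qed
  show "integrable unit_interval_measure (\<lambda>t. Omega_series w k (1 + t))"
    by (rule integral_convolution_psi(1)[OF measurable_Omega_series k conv bound sums]) (use K in auto)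
  show "\<bar>(LINT t|unit_interval_measure. Omega_series w k (1 + t)) - K\<bar> \<le> (4 * M * quad_geom + C) / sqrt k"
    by (rule integral_convolution_psi(2)[OF measurable_Omega_series k conv bound sums]) (use K in auto)
qed

text \<open>Tonelli for nonnegative terms. The integrability of the series, known from its expansion
  in the \<open>psi\<close> functions, is what makes the sum over n finite.\<close>

lemma erdos_has_sum_integral:
  assumes k: "k \<ge> 1" and int: "integrable unit_interval_measure (\<lambda>t. Omega_series w k (1 + t))"
  shows "((\<lambda>n. w n * (erdos_term n * (1 - 1 / real n)))
    has_sum (LINT t|unit_interval_measure. Omega_series w k (1 + t))) (almost_primes k)"
proof -
  let ?U = unit_interval_measure
  define f where "f n t = (if n \<in> almost_primes k then w n * real n powr - (1 + t) else 0)" for n t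
  define g where "g n = (if n \<in> almost_primes k then w n * (erdos_term n * (1 - 1 / real n)) else 0)" for n
  have f0: "f n t \<ge> 0" for n t using weight_nonneg by (simp add: f_def)
  have fi: "integrable ?U (f n)" "(LINT t|?U. f n t) = g n" for n
    using integral_nat_powr[OF almost_primes_ge_2[OF _ k], of n] by (cases "n \<in> almost_primes k"; simp add: f_def[abs_def] g_def)+
  have g0: "g n \<ge> 0" for n unfolding fi(2)[symmetric] by (intro integral_nonneg_AE AE_I2 f0)
  have fs: "(\<lambda>n. f n t) sums Omega_series w k (1 + t)" if "t \<in> space ?U" for t
    using Omega_series_nat_sums[of "1 + t" k] that by (simp add: f_def space_restrict_space)
  have O0: "Omega_series w k s \<ge> 0" for s
    unfolding Omega_series_def using weight_nonneg by (intro infsum_nonneg) auto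
  have "(\<Sum>n. ennreal (g n)) = (\<Sum>n. \<integral>\<^sup>+t. ennreal (f n t) \<partial>?U)"
    using fi f0 by (intro suminf_cong) (simp add: nn_integral_eq_integral)
  also have "\<dots> = (\<integral>\<^sup>+t. (\<Sum>n. ennreal (f n t)) \<partial>?U)"
    using fi(1) by (intro nn_integral_suminf[symmetric]) auto
  also have "\<dots> = (\<integral>\<^sup>+t. ennreal (Omega_series w k (1 + t)) \<partial>?U)"
    using fs f0 by (intro nn_integral_cong suminf_ennreal_eq) auto
  also have "\<dots> = ennreal (LINT t|?U. Omega_series w k (1 + t))"
    using int O0 by (intro nn_integral_eq_integral) auto
  finally have eq: "(\<Sum>n. ennreal (g n)) = ennreal (LINT t|?U. Omega_series w k (1 + t))" .
  then have sg: "summable g" using g0 by (intro summable_suminf_not_top) auto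
  then have "ennreal (\<Sum>n. g n) = ennreal (LINT t|?U. Omega_series w k (1 + t))"
    using eq g0 by (simp add: suminf_ennreal2)
  then have "(\<Sum>n. g n) = (LINT t|?U. Omega_series w k (1 + t))"
    using g0 sg O0 by (subst (asm) ennreal_inj) (auto intro!: suminf_nonneg integral_nonneg_AE)
  then have "g sums (LINT t|?U. Omega_series w k (1 + t))" using sg by (simp add: sums_iff)
  then have "(g has_sum (LINT t|?U. Omega_series w k (1 + t))) UNIV"
    using g0 by (intro sums_nonneg_imp_has_sum) auto
  also have "?this \<longleftrightarrow> ?thesis"
    by (rule has_sum_cong_neutral) (auto simp: g_def)
  finally show ?thesis .
qed

text \<open>The summand without its weight is the integral of n^(-s) over s > 2, that is 1/(n^2 log
  n). With log n >= k log 2 the sum is O(1/k), which is then weakened to O(1/sqrt k).\<close>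

lemma erdos_tail:
  assumes k: "k \<ge> 1"
  shows "(\<lambda>n. w n * (erdos_term n / real n)) summable_on almost_primes k"
    "\<bar>\<Sum>\<^sub>\<infinity>n\<in>almost_primes k. w n * (erdos_term n / real n)\<bar> \<le> nat_zeta 2 / ln 2 / sqrt k"
proof -
  have le: "w n * (erdos_term n / real n) \<le> (1 / (ln 2 * real k)) * real n powr - 2"
    if n: "n \<in> almost_primes k" for n
  proof -
    have n2: "n \<ge> 2" by (rule almost_primes_ge_2[OF n k])
    have "(2::real) ^ k \<le> real n"
      using two_power_prime_Omega_le[of n] n unfolding almost_primes_def
      by (metis (mono_tags, lifting) mem_Collect_eq of_nat_le_iff of_nat_numeral of_nat_power)
    then have "real k * ln 2 \<le> ln (real n)"
      using n2 by (subst ln_realpow[symmetric]) auto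
    then have "1 / ln (real n) \<le> 1 / (ln 2 * real k)"
      using k n2 by (intro divide_left_mono) (auto simp: mult.commute)
    then have "1 / ln (real n) * real n powr - 2 \<le> 1 / (ln 2 * real k) * real n powr - 2"
      by (rule mult_right_mono) simp
    moreover have "erdos_term n / real n = 1 / ln (real n) * real n powr - 2"
      using n2 by (simp add: erdos_term_def powr_minus_divide powr_numeral power2_eq_square)
    moreover have "w n * (erdos_term n / real n) \<le> erdos_term n / real n"
      using weight_nonneg weight_le_1 erdos_term_nonneg[of n] n2 by (intro mult_left_le_one_le) auto
    ultimately show ?thesis by linarith
  qed
  have nn: "0 \<le> w n * (erdos_term n / real n)" if "n \<in> almost_primes k" for n
    using weight_nonneg erdos_term_nonneg[of n] that by (auto simp: almost_primes_def)
  show sm: "(\<lambda>n. w n * (erdos_term n / real n)) summable_on almost_primes k"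
    by (rule summable_on_powr_bound[of 2, OF _ nn le]) auto
  have "(\<Sum>\<^sub>\<infinity>n\<in>almost_primes k. w n * (erdos_term n / real n))
      \<le> (\<Sum>\<^sub>\<infinity>n\<in>UNIV. (1 / (ln 2 * real k)) * real n powr - 2)"
  proof (rule infsum_mono_neutral[OF sm])
    show "(\<lambda>n. (1 / (ln 2 * real k)) * real n powr - 2) summable_on UNIV"
      by (intro summable_on_cmult_right summable_on_powr) simp
  qed (use le in auto)
  also have "\<dots> = 1 / (ln 2 * real k) * nat_zeta 2"
    unfolding nat_zeta_def by (rule infsum_cmult_right) (intro summable_on_powr, simp)
  also have "\<dots> \<le> nat_zeta 2 / ln 2 / sqrt k"
  proof -
    have "sqrt k \<le> real k" "sqrt k > 0"
      using k by (auto intro: real_le_lsqrt simp: power2_eq_square)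
    then have "nat_zeta 2 / ln 2 / real k \<le> nat_zeta 2 / ln 2 / sqrt k"
      using nat_zeta_ge_1[of 2] k by (intro divide_left_mono) auto
    then show ?thesis by simp
  qed
  finally show "\<bar>\<Sum>\<^sub>\<infinity>n\<in>almost_primes k. w n * (erdos_term n / real n)\<bar> \<le> nat_zeta 2 / ln 2 / sqrt k"
    using infsum_nonneg[of "almost_primes k" "\<lambda>n. w n * (erdos_term n / real n)"] nn by simp
qed

lemma weighted_erdos_sum:
  assumes K: "\<And>t. 0 < t \<Longrightarrow> t < 1 \<Longrightarrow> \<bar>t * exp (\<Sum>i. log_fps (1 + t) $ i) - K\<bar> \<le> C * t"
  shows "\<exists>D. \<forall>k\<ge>1. (\<lambda>n. w n * erdos_term n) summable_on almost_primes k \<and>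
    \<bar>(\<Sum>\<^sub>\<infinity>n\<in>almost_primes k. w n * erdos_term n) - K\<bar> \<le> D / sqrt k"
proof (intro exI allI impI)
  fix k :: nat assume k: "k \<ge> 1"
  let ?M = "growth_const (8 * nat_zeta 2 + 2 * ln 2)"
  let ?I = "LINT t|unit_interval_measure. Omega_series w k (1 + t)"
  let ?T = "\<Sum>\<^sub>\<infinity>n\<in>almost_primes k. w n * (erdos_term n / real n)"
  have "((\<lambda>n. w n * (erdos_term n * (1 - 1 / real n)) + w n * (erdos_term n / real n)) has_sum (?I + ?T))
      (almost_primes k)"
    by (rule has_sum_add[OF erdos_has_sum_integral[OF k integral_Omega_series(1)[OF K k]]
      has_sum_infsum[OF erdos_tail(1)[OF k]]])
  also have "(\<lambda>n. w n * (erdos_term n * (1 - 1 / real n)) + w n * (erdos_term n / real n))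
      = (\<lambda>n. w n * erdos_term n)"
    by (simp add: right_diff_distrib)
  finally have hs: "((\<lambda>n. w n * erdos_term n) has_sum (?I + ?T)) (almost_primes k)" .
  have "\<bar>?I + ?T - K\<bar> \<le> (4 * ?M * quad_geom + C) / sqrt k + nat_zeta 2 / ln 2 / sqrt k"
    using integral_Omega_series(2)[OF K k] erdos_tail(2)[OF k] by linarith
  also have "\<dots> = (4 * ?M * quad_geom + C + nat_zeta 2 / ln 2) / sqrt k"
    by (simp add: add_divide_distrib)
  finally show "(\<lambda>n. w n * erdos_term n) summable_on almost_primes k \<and>
    \<bar>(\<Sum>\<^sub>\<infinity>n\<in>almost_primes k. w n * erdos_term n) - K\<bar>
      \<le> (4 * ?M * quad_geom + C + nat_zeta 2 / ln 2) / sqrt k"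
    using has_sum_imp_summable[OF hs] infsumI[OF hs] by simp
qed

end

section \<open>The value at s = 2 and the final estimates\<close>

lemma nat_zeta_2: "nat_zeta 2 = pi\<^sup>2 / 6"
proof -
  have "(\<lambda>n. 1 / (real n + 1)\<^sup>2) sums nat_zeta 2"
    using nat_zeta_sums[of 2] by (simp add: powr_minus_divide powr_numeral add.commute)
  then show ?thesis using inverse_squares_sums by (simp add: sums_iff add.commute)
qed

text \<open>Reciprocals of numbers >= 1 are no further apart than the numbers. Termwise, 1 - n^(-2t)
  <= 2 t log n and log n <= 2 sqrt n, which costs half a power of n and leaves the convergent series
  of n^(-3/2).\<close>

lemma inverse_nat_zeta_near_2:
  assumes t: "t > 0"
  shows "\<bar>1 / nat_zeta (2 + 2 * t) - 1 / nat_zeta 2\<bar> \<le> 4 * nat_zeta (3/2) * t"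
proof -
  let ?a = "nat_zeta 2" and ?b = "nat_zeta (2 + 2 * t)"
  have z: "?a \<ge> 1" "?b \<ge> 1" using t by (auto intro: nat_zeta_ge_1)
  have ab: "(\<lambda>n. real (Suc n) powr - 2 - real (Suc n) powr - (2 + 2 * t)) sums (?a - ?b)"
    using t by (intro sums_diff nat_zeta_sums) auto
  have c: "(\<lambda>n. (4 * t) * real (Suc n) powr - (3/2)) sums ((4 * t) * nat_zeta (3/2))"
    by (intro sums_mult nat_zeta_sums) auto
  have b1: "0 \<le> real (Suc n) powr - 2 - real (Suc n) powr - (2 + 2 * t)" for n
    using t by (simp add: powr_mono del: of_nat_Suc)
  have b2: "real (Suc n) powr - 2 - real (Suc n) powr - (2 + 2 * t) \<le> (4 * t) * real (Suc n) powr - (3/2)" for n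
  proof -
    let ?x = "real (Suc n)"
    have x: "?x \<ge> 1" by simp
    have "1 - ?x powr - (2 * t) \<le> 2 * t * ln ?x"
      using exp_ge_add_one_self[of "- (2 * t) * ln ?x"] by (simp add: powr_def del: of_nat_Suc)
    also have "\<dots> \<le> 2 * t * (?x powr (1/2) / (1/2))"
      using t x by (intro mult_left_mono ln_powr_bound) auto
    finally have "?x powr - 2 * (1 - ?x powr - (2 * t)) \<le> ?x powr - 2 * (2 * t * (?x powr (1/2) / (1/2)))"
      by (rule mult_left_mono) simp
    also have "\<dots> = (4 * t) * (?x powr - 2 * ?x powr (1/2))" by simp
    also have "?x powr - 2 * ?x powr (1/2) = ?x powr - (3/2)" by (simp flip: powr_add)
    also have "?x powr - 2 * (1 - ?x powr - (2 * t)) = ?x powr - 2 - ?x powr - (2 + 2 * t)"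
      by (simp add: right_diff_distrib flip: powr_add)
    finally show ?thesis .
  qed
  have d: "0 \<le> ?a - ?b" "?a - ?b \<le> (4 * t) * nat_zeta (3/2)"
    using sums_le[OF b1 sums_zero ab] sums_le[OF b2 ab c] by auto
  have "1 / ?b - 1 / ?a = (?a - ?b) / (?a * ?b)" using z by (simp add: field_simps)
  also have "\<bar>\<dots>\<bar> \<le> (?a - ?b) / 1"
  proof -
    have "1 \<le> ?a * ?b" using mult_mono[OF z] z by simp
    then have "(?a - ?b) / (?a * ?b) \<le> (?a - ?b) / 1" using d by (intro divide_left_mono) auto
    then show ?thesis using d z by simp
  qed
  finally show ?thesis using d by (simp add: mult_ac)
qed

text \<open>The passage from the error O(k^(-1/2)) of the previous estimates to the exponent with
  \<epsilon>.\<close>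

lemma inverse_sqrt_le_powr:
  assumes "k \<ge> 1" "\<epsilon> > 0"
  shows "1 / sqrt (real k) \<le> real k powr (- 1 / 2 + \<epsilon>)"
proof -
  have "1 / sqrt (real k) = real k powr (- 1 / 2)"
    using assms by (simp add: powr_minus_divide powr_half_sqrt)
  also have "\<dots> \<le> real k powr (- 1 / 2 + \<epsilon>)" using assms by (intro powr_mono) auto
  finally show ?thesis .
qed

lemma powr_bound_of_sqrt_bound:
  fixes F :: "nat \<Rightarrow> real"
  assumes "\<And>k. k \<ge> 1 \<Longrightarrow> \<bar>F k\<bar> \<le> D / sqrt (real k)" "\<epsilon> > 0"
  shows "\<exists>C. \<forall>k\<ge>1. \<bar>F k\<bar> \<le> C * real k powr (- 1 / 2 + \<epsilon>)"
proof (intro exI allI impI)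
  fix k :: nat assume k: "k \<ge> 1"
  have "0 \<le> D" using assms(1)[of 1] by simp
  have "\<bar>F k\<bar> \<le> D * (1 / sqrt (real k))" using assms(1)[OF k] by simp
  also have "\<dots> \<le> D * real k powr (- 1 / 2 + \<epsilon>)"
    by (intro mult_left_mono inverse_sqrt_le_powr k assms \<open>0 \<le> D\<close>)
  finally show "\<bar>F k\<bar> \<le> D * real k powr (- 1 / 2 + \<epsilon>)" .
qed

lemma almost_primes_erdos_sum:
  "\<exists>D. \<forall>k\<ge>1. erdos_term summable_on almost_primes k \<and>
    \<bar>erdos_sum (almost_primes k) - 1\<bar> \<le> D / sqrt k"
proof -
  have "\<bar>t * exp (\<Sum>i. one_weight.log_fps (1 + t) $ i) - 1\<bar> \<le> 1 * t" if t: "0 < t" "t < 1" for t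
  proof -
    have "exp (\<Sum>i. one_weight.log_fps (1 + t) $ i) = nat_zeta (1 + t)"
      using nat_zeta_eq_exp(2)[of "1 + t"] t by (simp add: one_weight.log_fps_def)
    then show ?thesis using nat_zeta_bounds[OF t(1)] t by (simp add: field_simps abs_le_iff)
  qed
  from one_weight.weighted_erdos_sum[OF this] show ?thesis
    by (simp add: erdos_sum_def)
qed

lemma squarefree_almost_primes_erdos_sum:
  "\<exists>D. \<forall>k\<ge>1. erdos_term summable_on squarefree_almost_primes k \<and>
    \<bar>erdos_sum (squarefree_almost_primes k) - 6 / pi\<^sup>2\<bar> \<le> D / sqrt k"
proof -
  have "\<bar>t * exp (\<Sum>i. squarefree_weight.log_fps (1 + t) $ i) - 6 / pi\<^sup>2\<bar> \<le> (1 + 4 * nat_zeta (3/2)) * t"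
    if t: "0 < t" "t < 1" for t
  proof -
    let ?b = "nat_zeta (2 + 2 * t)"
    have b: "?b \<ge> 1" using t by (intro nat_zeta_ge_1) auto
    have "\<bar>(t * nat_zeta (1 + t) - 1) / ?b\<bar> \<le> \<bar>t * nat_zeta (1 + t) - 1\<bar>"
      using b by (simp add: divide_le_eq mult_le_cancel_left1)
    also have "\<dots> \<le> t"
      using nat_zeta_bounds[OF t(1)] t by (simp add: field_simps abs_le_iff)
    finally have 1: "\<bar>(t * nat_zeta (1 + t) - 1) / ?b\<bar> \<le> t" .
    \<comment> \<open>The two differences separate the errors from the pole of zeta at 1 and from
      the variation of 1/zeta near 2; their bounds t and 4 zeta(3/2) t add up to the constant
      claimed.\<close>
    have "t * exp (\<Sum>i. squarefree_weight.log_fps (1 + t) $ i) - 6 / pi\<^sup>2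
        = (t * nat_zeta (1 + t) - 1) / ?b + (1 / ?b - 1 / nat_zeta 2)"
      using t by (simp add: exp_squarefree_log diff_divide_distrib nat_zeta_2)
    then show ?thesis
      using order.trans[OF abs_triangle_ineq add_mono[OF 1 inverse_nat_zeta_near_2[OF t(1)]]]
      by (simp add: distrib_right)
  qed
  from squarefree_weight.weighted_erdos_sum[OF this]
  obtain D where D: "\<And>k. k \<ge> 1 \<Longrightarrow>
      (\<lambda>n. of_bool (squarefree n) * erdos_term n) summable_on almost_primes k \<and>
      \<bar>(\<Sum>\<^sub>\<infinity>n\<in>almost_primes k. of_bool (squarefree n) * erdos_term n) - 6 / pi\<^sup>2\<bar> \<le> D / sqrt k"
    by blast
  have "(\<lambda>n. of_bool (squarefree n) * erdos_term n) summable_on almost_primes k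
      \<longleftrightarrow> erdos_term summable_on squarefree_almost_primes k"
    "(\<Sum>\<^sub>\<infinity>n\<in>almost_primes k. of_bool (squarefree n) * erdos_term n)
      = erdos_sum (squarefree_almost_primes k)" for k
    unfolding erdos_sum_def
    by (intro summable_on_cong_neutral infsum_cong_neutral; auto simp: squarefree_almost_primes_def)+
  then show ?thesis using D by auto
qed

theorem theorem4p1:
  fixes \<epsilon> :: real
  assumes "\<epsilon> > 0"
  shows "(\<forall>k\<ge>1. erdos_term summable_on almost_primes k) \<and>
         (\<exists>C. \<forall>k\<ge>1. \<bar>erdos_sum (almost_primes k) - 1\<bar> \<le> C * real k powr (- 1 / 2 + \<epsilon>)) \<and>
         (\<forall>k\<ge>1. erdos_term summable_on squarefree_almost_primes k) \<and>
         (\<exists>C. \<forall>k\<ge>1. \<bar>erdos_sum (squarefree_almost_primes k) - 6 / pi\<^sup>2\<bar>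
                 \<le> C * real k powr (- 1 / 2 + \<epsilon>))"
proof -
  obtain D where D: "\<And>k. k \<ge> 1 \<Longrightarrow> erdos_term summable_on almost_primes k \<and>
      \<bar>erdos_sum (almost_primes k) - 1\<bar> \<le> D / sqrt k"
    using almost_primes_erdos_sum by blast
  obtain E where E: "\<And>k. k \<ge> 1 \<Longrightarrow> erdos_term summable_on squarefree_almost_primes k \<and>
      \<bar>erdos_sum (squarefree_almost_primes k) - 6 / pi\<^sup>2\<bar> \<le> E / sqrt k"
    using squarefree_almost_primes_erdos_sum by blast
  have "\<bar>erdos_sum (almost_primes k) - 1\<bar> \<le> D / sqrt k" if "k \<ge> 1" for k
    using D[OF that] by blast
  note 1 = powr_bound_of_sqrt_bound[OF this assms]
  have "\<bar>erdos_sum (squarefree_almost_primes k) - 6 / pi\<^sup>2\<bar> \<le> E / sqrt k" if "k \<ge> 1" for k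
    using E[OF that] by blast
  note 2 = powr_bound_of_sqrt_bound[OF this assms]
  show ?thesis
  proof (intro conjI allI impI 1 2)
    fix k :: nat assume "k \<ge> 1"
    then show "erdos_term summable_on almost_primes k" "erdos_term summable_on squarefree_almost_primes k"
      using D E by blast+
  qed
qed

end
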